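(* Let $X$ be a paracompact finite $C$-space, $(Y,\rho)$ a metric space, and $\varphi:X\rightrightarrows Y$ a $\rho$-continuous mapping such that each $\varphi(x)$, $x\in X$, is uniformly $UV^\omega$. Then for every continuous function $\varepsilon:X\to(0,+\infty)$, $\varphi$ has a continuous $\varepsilon$-selection.
   Context: A normal space $X$ is a finite $C$-space if for every sequence $\{\mathscr{U}_n:n<\omega\}$ of finite open covers of $X$ there is a finite sequence $\{\mathscr{V}_n:n\le k\}$ of families of pairwise disjoint open subsets of $X$ such that each $\mathscr{V}_n$ refines $\mathscr{U}_n$ and $\bigcup_{n\le k}\mathscr{V}_n$ covers $X$. A set-valued mapping $\varphi:X\rightrightarrows Y$ assigns a nonempty subset $\varphi(x)\subset Y$ to each $x$. $\mathbf{O}_\varepsilon(S)=\bigcup_{q\in S}\{y:\rho(y,q)<\varepsilon\}$. $\varphi$ is $\rho$-continuous if for every $\varepsilon>0$ each $x\in X$ has a neighbourhood $V$ with $\varphi(x)\subset\mathbf{O}_\varepsilon(\varphi(p))$ and $\varphi(p)\subset\mathbf{O}_\varepsilon(\varphi(x))$ for all $p\in V$. For $S\subset T$, $S\hookrightarrow_\omega T$ means that for every finite-dimensional simplicial complex $\Sigma$ (all simplices of cardinality at most some fixed $k+1$; geometric realisation $|\Sigma|$ with the Whitehead topology), every continuous map $g:|\Sigma|\to S$ is null-homotopic in $T$. A subset $S\subset Y$ is uniformly $UV^\omega$ if for each $\varepsilon>0$ there is $\delta\in(0,\varepsilon]$ with $\mathbf{O}_\delta(S)\hookrightarrow_\omega\mathbf{O}_\varepsilon(S)$.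 A map $f:X\to Y$ is an $\varepsilon$-selection for $\varphi$ if $f(x)\in\mathbf{O}_{\varepsilon(x)}(\varphi(x))$ for every $x\in X$. *)

theory Defs
  imports "HOL-Analysis.Analysis"
begin

text \<open>Paracompact (Engelking convention: Hausdorff, and every open cover has a
locally finite open refinement).\<close>
definition paracompact_space :: "'a topology \<Rightarrow> bool" where
  "paracompact_space X \<longleftrightarrow> Hausdorff_space X \<and>
     (\<forall>\<U>. (\<forall>U\<in>\<U>. openin X U) \<and> \<Union>\<U> = topspace X \<longrightarrow>
        (\<exists>\<V>. (\<forall>V\<in>\<V>. openin X V) \<and> \<Union>\<V> = topspace X \<and>
              (\<forall>V\<in>\<V>. \<exists>U\<in>\<U>. V \<subseteq> U) \<and> locally_finite_in X \<V>))"

definition finite_open_cover :: "'a topology \<Rightarrow> 'a set set \<Rightarrow> bool" where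
  "finite_open_cover X \<U> \<longleftrightarrow> finite \<U> \<and> (\<forall>U\<in>\<U>. openin X U) \<and> \<Union>\<U> = topspace X"

definition finite_C_space :: "'a topology \<Rightarrow> bool" where
  "finite_C_space X \<longleftrightarrow> normal_space X \<and>
     (\<forall>\<U> :: nat \<Rightarrow> 'a set set. (\<forall>n. finite_open_cover X (\<U> n)) \<longrightarrow>
        (\<exists>k. \<exists>\<V> :: nat \<Rightarrow> 'a set set.
           (\<forall>n\<le>k. (\<forall>V\<in>\<V> n. openin X V \<and> (\<exists>U\<in>\<U> n. V \<subseteq> U)) \<and> pairwise disjnt (\<V> n)) \<and>
           (\<Union>n\<le>k. \<Union>(\<V> n)) = topspace X))"

definition Onbhd :: "'b metric \<Rightarrow> real \<Rightarrow> 'b set \<Rightarrow> 'b set" where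
  "Onbhd m e S = {y \<in> mspace m. \<exists>q\<in>S. mdist m y q < e}"

definition rho_continuous :: "'a topology \<Rightarrow> 'b metric \<Rightarrow> ('a \<Rightarrow> 'b set) \<Rightarrow> bool" where
  "rho_continuous X m \<phi> \<longleftrightarrow>
     (\<forall>e>0. \<forall>x\<in>topspace X. \<exists>V. openin X V \<and> x \<in> V \<and>
        (\<forall>p\<in>V. \<phi> x \<subseteq> Onbhd m e (\<phi> p) \<and> \<phi> p \<subseteq> Onbhd m e (\<phi> x)))"

definition simplicial_complex :: "'v set set \<Rightarrow> bool" where
  "simplicial_complex \<Sigma> \<longleftrightarrow>
     (\<forall>\<sigma>\<in>\<Sigma>. finite \<sigma> \<and> \<sigma> \<noteq> {} \<and> (\<forall>\<tau>. \<tau> \<subseteq> \<sigma> \<and> \<tau> \<noteq> {} \<longrightarrow> \<tau> \<in> \<Sigma>))"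

definition finite_dimensional :: "'v set set \<Rightarrow> bool" where
  "finite_dimensional \<Sigma> \<longleftrightarrow> (\<exists>k::nat. \<forall>\<sigma>\<in>\<Sigma>. card \<sigma> \<le> k + 1)"

text \<open>Closed geometric simplex of \<sigma>, as barycentric coordinate functions.\<close>
definition geom_simplex :: "'v set \<Rightarrow> ('v \<Rightarrow> real) set" where
  "geom_simplex \<sigma> = {\<alpha>. (\<forall>v. 0 \<le> \<alpha> v) \<and> (\<forall>v. v \<notin> \<sigma> \<longrightarrow> \<alpha> v = 0) \<and> sum \<alpha> \<sigma> = 1}"

definition realization :: "'v set set \<Rightarrow> ('v \<Rightarrow> real) set" where
  "realization \<Sigma> = (\<Union>\<sigma>\<in>\<Sigma>. geom_simplex \<sigma>)"

text \<open>Whitehead (weak) topology: U is open iff its trace on every closed simplex is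
open in the Euclidean topology of that simplex.\<close>
definition whitehead_topology :: "'v set set \<Rightarrow> ('v \<Rightarrow> real) topology" where
  "whitehead_topology \<Sigma> = topology (\<lambda>U. U \<subseteq> realization \<Sigma> \<and>
      (\<forall>\<sigma>\<in>\<Sigma>. openin (subtopology (powertop_real UNIV) (geom_simplex \<sigma>)) (U \<inter> geom_simplex \<sigma>)))"

definition hook_omega :: "'v itself \<Rightarrow> 'b metric \<Rightarrow> 'b set \<Rightarrow> 'b set \<Rightarrow> bool" where
  "hook_omega _ m S T \<longleftrightarrow>
     (\<forall>(\<Sigma> :: 'v set set) (g :: ('v \<Rightarrow> real) \<Rightarrow> 'b).
        simplicial_complex \<Sigma> \<and> finite_dimensional \<Sigma> \<and>
        continuous_map (whitehead_topology \<Sigma>) (subtopology (mtopology_of m) S) g \<longrightarrow>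
        (\<exists>c. homotopic_with (\<lambda>h. True) (whitehead_topology \<Sigma>)
               (subtopology (mtopology_of m) T) g (\<lambda>_. c)))"

definition uniformly_UV_omega :: "'v itself \<Rightarrow> 'b metric \<Rightarrow> 'b set \<Rightarrow> bool" where
  "uniformly_UV_omega V m S \<longleftrightarrow>
     (\<forall>e>0. \<exists>d. 0 < d \<and> d \<le> e \<and> hook_omega V m (Onbhd m d S) (Onbhd m e S))"

end

theory Submission
  imports Defs
begin

text \<open>
  The finite C-property, assumed for finite covers only, extends to arbitrary open covers of a
  paracompact space. Call a set refinable if there is a bound d such that every open cover of X
  has d disjoint open families refining it and covering the set. Given a continuous real function
  f, the strips f^{-1}[n, n+1] with n large have uniformly bounded dimension: otherwise essential
  families of pairs on sparser and sparser strips glue to one sequence of pairs of disjoint closed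
  sets that contradicts the finite C-property. Hence some superlevel set of f is refinable. So the
  points without a refinable neighbourhood form a compact set K, and every closed set disjoint
  from K is refinable; K is handled with finite covers and the rest with boundedly many families.

  For the selection, choose continuous scales E 0 = \<epsilon>, E 1, E 2, ... and covers such that on each
  member of the n-th cover the E (n+1)-neighbourhoods of the values of \<phi> lie in a set that is
  contractible, in the sense of the UV property, inside all the E n-neighbourhoods. Disjoint
  families refining these covers have a finite-dimensional nerve, which is mapped to Y by
  descending induction on the level, coning off the link of each vertex. Composing with a
  partition of unity gives the selection.
\<close>

section \<open>Bump families\<close>

text \<open>Two things resist a direct argument: arbitrary covers are infinite while the finite
  C-property sees only finite ones, and numbers attached to points need not be bounded. Both are met
  by encoding data in a continuous real function. The bumps of a cover are deliberately not
  normalised; at every point some bump equals 1, so a weighted sum of bumps is at least the total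
  weight of the peaks there. Bounding one continuous function thus bounds the number of peaks, or
  whatever numbers serve as weights. On a strip of the unweighted sum an infinite cover is
  represented by finitely many unions of disjoint families; dimension theory for finite covers
  applies to these unions, which are split afterwards without raising the number of families. Bounds
  must be uniform in the cover, because the leftover set is served by a common refinement of as many
  later covers as there are families. In the selection, the level of a family decides the scale at
  which its vertices are coned off; as the members of one family are disjoint, a simplex has at most
  one vertex of each level.\<close>

definition bump_family ::
    "'a topology \<Rightarrow> 'i set \<Rightarrow> ('i \<Rightarrow> 'a set) \<Rightarrow> ('i \<Rightarrow> 'a \<Rightarrow> real) \<Rightarrow> bool" where
  "bump_family X I U u \<longleftrightarrow>
     (\<forall>i\<in>I. continuous_map X euclideanreal (u i)) \<and>
     (\<forall>i\<in>I. \<forall>x\<in>topspace X. 0 \<le> u i x \<and> u i x \<le> 1 \<and> (u i x \<noteq> 0 \<longrightarrow> x \<in> U i)) \<and>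
     (\<forall>x\<in>topspace X. \<exists>i\<in>I. u i x = 1) \<and>
     (\<forall>x\<in>topspace X. \<exists>N. openin X N \<and> x \<in> N \<and> finite {i\<in>I. \<exists>y\<in>N. u i y \<noteq> 0})"

lemma paracompactE:
  assumes "paracompact_space X" "\<And>U. U \<in> \<U> \<Longrightarrow> openin X U" "\<Union>\<U> = topspace X"
  obtains \<V> where "\<forall>V\<in>\<V>. openin X V" "\<Union>\<V> = topspace X"
    "\<forall>V\<in>\<V>. \<exists>U\<in>\<U>. V \<subseteq> U" "locally_finite_in X \<V>"
proof -
  have "(\<forall>U\<in>\<U>. openin X U) \<and> \<Union>\<U> = topspace X" using assms(2,3) by blast
  then have "\<exists>\<V>. (\<forall>V\<in>\<V>. openin X V) \<and> \<Union>\<V> = topspace X \<and>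
      (\<forall>V\<in>\<V>. \<exists>U\<in>\<U>. V \<subseteq> U) \<and> locally_finite_in X \<V>"
    using assms(1) unfolding paracompact_space_def by (elim conjE allE[of _ \<U>]) simp
  then show ?thesis using that by (elim exE conjE)
qed

text \<open>Normality and closed points give open sets whose closures lie in members
  \<open>U i\<close>; a locally finite refinement of these is regrouped by a chosen index. Closure
  commutes with locally finite unions, so the regrouped sets still have closures inside
  \<open>U i\<close>.\<close>

lemma paracompact_shrinking:
  assumes pc: "paracompact_space X" and nX: "normal_space X"
    and U: "\<And>i. i \<in> I \<Longrightarrow> openin X (U i)" and cov: "topspace X \<subseteq> (\<Union>i\<in>I. U i)"
  shows "\<exists>W. (\<forall>i\<in>I. openin X (W i) \<and> X closure_of (W i) \<subseteq> U i) \<and> topspace X \<subseteq> (\<Union>i\<in>I. W i) \<and>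
    (\<forall>x\<in>topspace X. \<exists>N. openin X N \<and> x \<in> N \<and> finite {i\<in>I. W i \<inter> N \<noteq> {}})"
proof -
  let ?O = "{G. openin X G \<and> (\<exists>i\<in>I. X closure_of G \<subseteq> U i)}"
  have haus: "Hausdorff_space X"
    using pc by (simp add: paracompact_space_def)
  have covO: "\<Union>?O = topspace X"
  proof
    show "\<Union>?O \<subseteq> topspace X" by (auto dest: openin_subset)
    show "topspace X \<subseteq> \<Union>?O"
    proof
      fix x assume x: "x \<in> topspace X"
      then obtain i where i: "i \<in> I" "x \<in> U i" using cov by blast
      have "closedin X {x}"
        by (simp add: closedin_Hausdorff_singleton haus x)
      moreover have "{x} \<subseteq> U i" using i by simp
      ultimately obtain G where "openin X G" "{x} \<subseteq> G" "X closure_of G \<subseteq> U i"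
        using nX U[OF i(1)] unfolding normal_space_alt by meson
      then show "x \<in> \<Union>?O" using i by blast
    qed
  qed
  obtain \<W> where W: "\<forall>V\<in>\<W>. openin X V" "\<Union>\<W> = topspace X"
      "\<forall>V\<in>\<W>. \<exists>G\<in>?O. V \<subseteq> G" "locally_finite_in X \<W>"
    by (rule paracompactE[OF pc _ covO]) auto
  have "\<exists>i. i \<in> I \<and> X closure_of V \<subseteq> U i" if "V \<in> \<W>" for V
  proof -
    obtain G i where "V \<subseteq> G" "i \<in> I" "X closure_of G \<subseteq> U i"
      using W(3) \<open>V \<in> \<W>\<close> by blast
    then show ?thesis using closure_of_mono[of V G X] by blast
  qed
  then obtain s where s: "\<And>V. V \<in> \<W> \<Longrightarrow> s V \<in> I \<and> X closure_of V \<subseteq> U (s V)"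
    by metis
  define Z where "Z i = \<Union>{V\<in>\<W>. s V = i}" for i
  show ?thesis
  proof (intro exI[of _ Z] conjI ballI)
    show "openin X (Z i)" for i
      unfolding Z_def using W(1) by blast
    show "X closure_of (Z i) \<subseteq> U i" if "i \<in> I" for i
    proof -
      have lf: "locally_finite_in X {V\<in>\<W>. s V = i}"
        by (rule locally_finite_in_subset[OF W(4)]) auto
      have "X closure_of (Z i) = \<Union>((closure_of) X ` {V\<in>\<W>. s V = i})"
        unfolding Z_def by (rule closure_of_locally_finite_Union[OF lf])
      then show ?thesis using s by blast
    qed
    show "topspace X \<subseteq> (\<Union>i\<in>I. Z i)"
      unfolding Z_def using W(2) s by blast
    show "\<exists>N. openin X N \<and> x \<in> N \<and> finite {i\<in>I. Z i \<inter> N \<noteq> {}}" if x: "x \<in> topspace X" for x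
    proof -
      obtain N where N: "openin X N" "x \<in> N" "finite {V\<in>\<W>. V \<inter> N \<noteq> {}}"
        using W(4) x unfolding locally_finite_in_def by blast
      have "{i\<in>I. Z i \<inter> N \<noteq> {}} \<subseteq> s ` {V\<in>\<W>. V \<inter> N \<noteq> {}}"
        unfolding Z_def by blast
      then show ?thesis using N by (meson finite_imageI finite_subset)
    qed
  qed
qed

text \<open>Shrink twice, \<open>Z i\<close> inside \<open>W i\<close> inside \<open>U i\<close>,
  and take Urysohn functions that are 1 on the closure of \<open>Z i\<close> and 0 off
  \<open>W i\<close>. The cover by the \<open>Z i\<close> supplies the value 1 at every point; local
  finiteness of the \<open>W i\<close> passes to the supports.\<close>

lemma bump_family_exists:
  assumes pc: "paracompact_space X" and nX: "normal_space X"
    and U: "\<And>i. i \<in> I \<Longrightarrow> openin X (U i)" and cov: "topspace X \<subseteq> (\<Union>i\<in>I. U i)"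
  shows "\<exists>u. bump_family X I U u"
proof -
  have "\<exists>W. (\<forall>i\<in>I. openin X (W i) \<and> X closure_of (W i) \<subseteq> U i) \<and> topspace X \<subseteq> (\<Union>i\<in>I. W i) \<and>
    (\<forall>x\<in>topspace X. \<exists>N. openin X N \<and> x \<in> N \<and> finite {i\<in>I. W i \<inter> N \<noteq> {}})"
    using pc nX U cov by (rule paracompact_shrinking)
  then obtain W where W0: "\<forall>i\<in>I. openin X (W i) \<and> X closure_of (W i) \<subseteq> U i" and
     W3: "topspace X \<subseteq> (\<Union>i\<in>I. W i)" and
     W4: "\<forall>x\<in>topspace X. \<exists>N. openin X N \<and> x \<in> N \<and> finite {i\<in>I. W i \<inter> N \<noteq> {}}"
    by (elim exE conjE)
  have W: "\<And>i. i \<in> I \<Longrightarrow> openin X (W i)" "\<And>i. i \<in> I \<Longrightarrow> X closure_of (W i) \<subseteq> U i"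
    using W0 by auto
  have "\<exists>Z. (\<forall>i\<in>I. openin X (Z i) \<and> X closure_of (Z i) \<subseteq> W i) \<and> topspace X \<subseteq> (\<Union>i\<in>I. Z i) \<and>
    (\<forall>x\<in>topspace X. \<exists>N. openin X N \<and> x \<in> N \<and> finite {i\<in>I. Z i \<inter> N \<noteq> {}})"
    using pc nX W(1) W3 by (rule paracompact_shrinking)
  then obtain Z where Z0: "\<forall>i\<in>I. openin X (Z i) \<and> X closure_of (Z i) \<subseteq> W i" and
     Z3: "topspace X \<subseteq> (\<Union>i\<in>I. Z i)"
    by (elim exE conjE)
  have Z: "\<And>i. i \<in> I \<Longrightarrow> openin X (Z i)" "\<And>i. i \<in> I \<Longrightarrow> X closure_of (Z i) \<subseteq> W i"
    using Z0 by auto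
  have "\<exists>f. continuous_map X (top_of_set {0..1::real}) f \<and> f ` (topspace X - W i) \<subseteq> {0} \<and>
            f ` (X closure_of Z i) \<subseteq> {1}" if "i \<in> I" for i
  proof -
    have "closedin X (topspace X - W i)" "closedin X (X closure_of Z i)"
         "disjnt (topspace X - W i) (X closure_of Z i)"
      using W(1)[OF that] Z(2)[OF that] by (auto simp: disjnt_iff)
    then show ?thesis
      by (rule Urysohn_lemma[OF nX, of _ _ 0 1]) auto
  qed
  then obtain u where u: "\<And>i. i \<in> I \<Longrightarrow> continuous_map X (top_of_set {0..1::real}) (u i)"
     "\<And>i. i \<in> I \<Longrightarrow> u i ` (topspace X - W i) \<subseteq> {0}" "\<And>i. i \<in> I \<Longrightarrow> u i ` (X closure_of Z i) \<subseteq> {1}"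
    by metis
  have WU: "W i \<subseteq> U i" if "i \<in> I" for i
    using W(1,2)[OF that] by (meson closure_of_subset openin_subset subset_trans)
  have supp: "x \<in> W i" if "i \<in> I" "x \<in> topspace X" "u i x \<noteq> 0" for i x
    using u(2)[OF that(1)] that by blast
  have "bump_family X I U u"
    unfolding bump_family_def
  proof (intro conjI ballI impI)
    fix i assume "i \<in> I"
    then show "continuous_map X euclideanreal (u i)"
      using u(1) continuous_map_in_subtopology by blast
  next
    fix x assume x: "x \<in> topspace X"
    show "\<exists>i\<in>I. u i x = 1"
    proof -
      obtain i where i: "i \<in> I" "x \<in> Z i" using Z3 x by blast
      then have "x \<in> X closure_of Z i"
        using closure_of_subset[OF openin_subset[OF Z(1)[OF i(1)]]] by blast
      then show ?thesis using u(3) i by blast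
    qed
    obtain N where N: "openin X N" "x \<in> N" "finite {i\<in>I. W i \<inter> N \<noteq> {}}"
      using W4 x by blast
    have "{i\<in>I. \<exists>y\<in>N. u i y \<noteq> 0} \<subseteq> {i\<in>I. W i \<inter> N \<noteq> {}}"
      using supp openin_subset[OF N(1)] by blast
    then show "\<exists>N. openin X N \<and> x \<in> N \<and> finite {i\<in>I. \<exists>y\<in>N. u i y \<noteq> 0}"
      using N finite_subset by blast
  next
    fix i x assume "i \<in> I" "x \<in> topspace X"
    then have "u i x \<in> {0..1}"
      using u(1)[of i] continuous_map_image_subset_topspace by fastforce
    then show "0 \<le> u i x" "u i x \<le> 1" by auto
  next
    fix i x assume "i \<in> I" "x \<in> topspace X" "u i x \<noteq> 0"
    then show "x \<in> U i" using supp WU by blast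
  qed
  then show ?thesis by (rule exI[of _ u])
qed

lemma bump_familyD:
  assumes "bump_family X I U u"
  shows "\<And>i. i \<in> I \<Longrightarrow> continuous_map X euclideanreal (u i)"
    and "\<And>i x. i \<in> I \<Longrightarrow> x \<in> topspace X \<Longrightarrow> 0 \<le> u i x"
    and "\<And>i x. i \<in> I \<Longrightarrow> x \<in> topspace X \<Longrightarrow> u i x \<le> 1"
    and "\<And>i x. i \<in> I \<Longrightarrow> x \<in> topspace X \<Longrightarrow> u i x \<noteq> 0 \<Longrightarrow> x \<in> U i"
    and "\<And>x. x \<in> topspace X \<Longrightarrow> \<exists>i\<in>I. u i x = 1"
    and "\<And>x. x \<in> topspace X \<Longrightarrow> \<exists>N. openin X N \<and> x \<in> N \<and> finite {i\<in>I. \<exists>y\<in>N. u i y \<noteq> 0}"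
proof -
  note u = assms[unfolded bump_family_def]
  note u1 = conjunct1[OF u] and u2 = conjunct1[OF conjunct2[OF u]]
    and u3 = conjunct1[OF conjunct2[OF conjunct2[OF u]]]
    and u4 = conjunct2[OF conjunct2[OF conjunct2[OF u]]]
  show "\<And>i. i \<in> I \<Longrightarrow> continuous_map X euclideanreal (u i)"
    using u1 by (rule bspec)
  show "\<And>i x. i \<in> I \<Longrightarrow> x \<in> topspace X \<Longrightarrow> 0 \<le> u i x"
    and "\<And>i x. i \<in> I \<Longrightarrow> x \<in> topspace X \<Longrightarrow> u i x \<le> 1"
    and "\<And>i x. i \<in> I \<Longrightarrow> x \<in> topspace X \<Longrightarrow> u i x \<noteq> 0 \<Longrightarrow> x \<in> U i"
    using u2 by blast+
  show "\<And>x. x \<in> topspace X \<Longrightarrow> \<exists>i\<in>I. u i x = 1"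
    using u3 by (rule bspec)
  show "\<And>x. x \<in> topspace X \<Longrightarrow> \<exists>N. openin X N \<and> x \<in> N \<and> finite {i\<in>I. \<exists>y\<in>N. u i y \<noteq> 0}"
    using u4 by (rule bspec)
qed

lemma bump_family_finite_support:
  assumes "bump_family X I U u" "x \<in> topspace X"
  shows "finite {i\<in>I. u i x \<noteq> 0}"
proof -
  obtain N where N: "x \<in> N" "finite {i\<in>I. \<exists>y\<in>N. u i y \<noteq> 0}"
    using bump_familyD(6)[OF assms] by blast
  show ?thesis
    by (rule finite_subset[OF _ N(2)]) (use N(1) in blast)
qed

text \<open>Only the indices active at \<open>x\<close> are summed, since \<open>I\<close> may be
  infinite and a HOL sum over an infinite set is 0.\<close>

definition weighted_sum :: "'i set \<Rightarrow> ('i \<Rightarrow> real) \<Rightarrow> ('i \<Rightarrow> 'a \<Rightarrow> real) \<Rightarrow> 'a \<Rightarrow> real" where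
  "weighted_sum I c u x = (\<Sum>i\<in>{i\<in>I. u i x \<noteq> 0}. c i * u i x)"

lemma continuous_map_openin_cover:
  assumes "\<And>x. x \<in> topspace X \<Longrightarrow> \<exists>N. openin X N \<and> x \<in> N \<and> continuous_map (subtopology X N) Y f"
  shows "continuous_map X Y f"
proof -
  obtain N where N: "\<And>x. x \<in> topspace X \<Longrightarrow> openin X (N x) \<and> x \<in> N x \<and> continuous_map (subtopology X (N x)) Y f"
    using assms by metis
  show ?thesis
    by (rule pasting_lemma[where I="topspace X" and T=N and f="\<lambda>_. f"]) (use N in auto)
qed

lemma continuous_map_weighted_sum:
  assumes u: "bump_family X I U u"
  shows "continuous_map X euclideanreal (weighted_sum I c u)"
proof (rule continuous_map_openin_cover)
  fix x assume "x \<in> topspace X"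
  then obtain N where N: "openin X N" "x \<in> N" and fin: "finite {i\<in>I. \<exists>y\<in>N. u i y \<noteq> 0}"
    using bump_familyD(6)[OF u] by blast
  let ?F = "{i\<in>I. \<exists>y\<in>N. u i y \<noteq> 0}"
  have "continuous_map (subtopology X N) euclideanreal (weighted_sum I c u)"
  proof (rule continuous_map_eq)
    have "continuous_map (subtopology X N) euclideanreal (u i)" if "i \<in> I" for i
      using bump_familyD(1)[OF u that] continuous_map_from_subtopology by blast
    then show "continuous_map (subtopology X N) euclideanreal (\<lambda>y. \<Sum>i\<in>?F. c i * u i y)"
      using fin by (intro continuous_intros) auto
    show "(\<Sum>i\<in>?F. c i * u i y) = weighted_sum I c u y"
      if "y \<in> topspace (subtopology X N)" for y
      unfolding weighted_sum_def
      by (rule sum.mono_neutral_right[OF fin]) (use that in auto)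
  qed
  then show "\<exists>N. openin X N \<and> x \<in> N \<and> continuous_map (subtopology X N) euclideanreal (weighted_sum I c u)"
    using N by blast
qed

text \<open>A peak contributes its full coefficient, which normalisation would destroy. The weights
  are used as a count (all 1), as an enumeration, and as local bounds.\<close>

lemma weighted_sum_ge_sum:
  assumes u: "bump_family X I U u" and x: "x \<in> topspace X"
    and c: "\<And>i. i \<in> I \<Longrightarrow> 0 \<le> c i" and J: "J \<subseteq> {i\<in>I. u i x = 1}"
  shows "sum c J \<le> weighted_sum I c u x"
proof -
  have "sum c J = (\<Sum>i\<in>J. c i * u i x)"
    using J by (intro sum.cong) auto
  also have "\<dots> \<le> weighted_sum I c u x"
    unfolding weighted_sum_def
    by (rule sum_mono2[OF bump_family_finite_support[OF u x]])
       (use J c bump_familyD(2)[OF u _ x] in auto)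
  finally show ?thesis .
qed

section \<open>Disjoint open refinements\<close>

text \<open>The members are open in \<open>X\<close>, not merely in \<open>A\<close>, and may stick
  out of \<open>A\<close>; so families for different sets can be put side by side.\<close>

definition disjoint_refinements :: "'a topology \<Rightarrow> nat \<Rightarrow> 'a set set \<Rightarrow> 'a set \<Rightarrow> bool" where
  "disjoint_refinements X d \<U> A \<longleftrightarrow>
     (\<exists>\<W> :: nat \<Rightarrow> 'a set set.
        (\<forall>i<d. pairwise disjnt (\<W> i) \<and> (\<forall>V\<in>\<W> i. openin X V \<and> (\<exists>U\<in>\<U>. V \<subseteq> U))) \<and>
        A \<subseteq> (\<Union>i<d. \<Union>(\<W> i)))"

lemma disjoint_refinementsE:
  assumes "disjoint_refinements X d \<U> A"
  obtains \<W> where "\<And>i. i < d \<Longrightarrow> pairwise disjnt (\<W> i)" "\<And>i V. i < d \<Longrightarrow> V \<in> \<W> i \<Longrightarrow> openin X V"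
    "\<And>i V. i < d \<Longrightarrow> V \<in> \<W> i \<Longrightarrow> \<exists>U\<in>\<U>. V \<subseteq> U" "A \<subseteq> (\<Union>i<d. \<Union>(\<W> i))"
  using assms unfolding disjoint_refinements_def by metis

lemma disjoint_refinementsI:
  assumes "\<And>i. i < d \<Longrightarrow> pairwise disjnt (\<W> i)" "\<And>i V. i < d \<Longrightarrow> V \<in> \<W> i \<Longrightarrow> openin X V"
    "\<And>i V. i < d \<Longrightarrow> V \<in> \<W> i \<Longrightarrow> \<exists>U\<in>\<U>. V \<subseteq> U" "A \<subseteq> (\<Union>i<d. \<Union>(\<W> i))"
  shows "disjoint_refinements X d \<U> A"
  using assms unfolding disjoint_refinements_def by (intro exI[of _ \<W>]) simp

lemma disjoint_refinements_subset:
  assumes "disjoint_refinements X d \<U> A" "B \<subseteq> A"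
  shows "disjoint_refinements X d \<U> B"
  using assms unfolding disjoint_refinements_def by (meson subset_trans)

lemma disjoint_refinements_Un:
  assumes "disjoint_refinements X d \<U> A" "disjoint_refinements X e \<U> B"
  shows "disjoint_refinements X (d + e) \<U> (A \<union> B)"
proof -
  obtain \<V> where V: "\<And>i. i < d \<Longrightarrow> pairwise disjnt (\<V> i)" "\<And>i V. i < d \<Longrightarrow> V \<in> \<V> i \<Longrightarrow> openin X V"
    "\<And>i V. i < d \<Longrightarrow> V \<in> \<V> i \<Longrightarrow> \<exists>U\<in>\<U>. V \<subseteq> U" "A \<subseteq> (\<Union>i<d. \<Union>(\<V> i))"
    by (rule disjoint_refinementsE[OF assms(1)]) (rule that)
  obtain \<W> where W: "\<And>i. i < e \<Longrightarrow> pairwise disjnt (\<W> i)" "\<And>i V. i < e \<Longrightarrow> V \<in> \<W> i \<Longrightarrow> openin X V"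
    "\<And>i V. i < e \<Longrightarrow> V \<in> \<W> i \<Longrightarrow> \<exists>U\<in>\<U>. V \<subseteq> U" "B \<subseteq> (\<Union>i<e. \<Union>(\<W> i))"
    by (rule disjoint_refinementsE[OF assms(2)]) (rule that)
  let ?Z = "\<lambda>i. if i < d then \<V> i else \<W> (i - d)"
  have lt: "i - d < e" if "i < d + e" "\<not> i < d" for i using that by auto
  show ?thesis
  proof (rule disjoint_refinementsI[where \<W>="?Z"])
    fix i assume i: "i < d + e"
    show "pairwise disjnt (?Z i)" using V(1) W(1) lt[OF i] by simp
    fix S assume "S \<in> ?Z i"
    then show "openin X S" "\<exists>U\<in>\<U>. S \<subseteq> U"
      using V(2,3) W(2,3) lt[OF i] by (auto split: if_splits)
  next
    show "A \<union> B \<subseteq> (\<Union>i<d+e. \<Union>(?Z i))"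
    proof
      fix x assume "x \<in> A \<union> B"
      then show "x \<in> (\<Union>i<d+e. \<Union>(?Z i))"
      proof
        assume "x \<in> A"
        then obtain i where "i < d" "x \<in> \<Union>(\<V> i)" using V(4) by blast
        then show ?thesis by (intro UN_I[of i]) auto
      next
        assume "x \<in> B"
        then obtain i where "i < e" "x \<in> \<Union>(\<W> i)" using W(4) by blast
        then show ?thesis by (intro UN_I[of "d + i"]) auto
      qed
    qed
  qed
qed

lemma disjoint_refinements_UN_lessThan:
  assumes "\<And>j. j < n \<Longrightarrow> disjoint_refinements X d \<U> (A j)"
  shows "disjoint_refinements X (n * d) \<U> (\<Union>j<n. A j)"
  using assms
proof (induction n)
  case 0
  then show ?case by (auto simp: disjoint_refinements_def)
next
  case (Suc n)
  have "disjoint_refinements X (d + n * d) \<U> (A n \<union> (\<Union>j<n. A j))"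
    by (intro disjoint_refinements_Un Suc) auto
  then show ?case by (simp add: lessThan_Suc)
qed

lemma disjoint_refinements_mono:
  assumes "disjoint_refinements X d \<U> A" "d \<le> e"
  shows "disjoint_refinements X e \<U> A"
proof -
  have "disjoint_refinements X (e - d) \<U> {}"
    unfolding disjoint_refinements_def by (intro exI[of _ "\<lambda>_. {}"]) auto
  from disjoint_refinements_Un[OF assms(1) this] assms(2) show ?thesis by simp
qed

text \<open>Intersecting with the disjoint sets \<open>G i\<close> separates the families of
  different \<open>i\<close>, so equally numbered ones are merged and \<open>d\<close> does not grow
  with the number of pieces.\<close>

lemma disjoint_refinements_disjoint_UN:
  fixes X :: "'a topology"
  assumes op: "\<And>i. i \<in> I \<Longrightarrow> openin X (G i)"
    and disj: "\<And>i j. i \<in> I \<Longrightarrow> j \<in> I \<Longrightarrow> i \<noteq> j \<Longrightarrow> disjnt (G i) (G j)"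
    and AG: "\<And>i. i \<in> I \<Longrightarrow> A i \<subseteq> G i"
    and ref: "\<And>i. i \<in> I \<Longrightarrow> disjoint_refinements X d \<U> (A i)"
  shows "disjoint_refinements X d \<U> (\<Union>i\<in>I. A i)"
proof -
  have "\<forall>i\<in>I. \<exists>\<W> :: nat \<Rightarrow> 'a set set.
        (\<forall>n<d. pairwise disjnt (\<W> n) \<and> (\<forall>V\<in>\<W> n. openin X V \<and> (\<exists>U\<in>\<U>. V \<subseteq> U))) \<and>
        A i \<subseteq> (\<Union>n<d. \<Union>(\<W> n))"
    using ref unfolding disjoint_refinements_def by blast
  then obtain \<W> where W: "\<forall>i\<in>I. (\<forall>n<d. pairwise disjnt (\<W> i n) \<and>
         (\<forall>V\<in>\<W> i n. openin X V \<and> (\<exists>U\<in>\<U>. V \<subseteq> U))) \<and> A i \<subseteq> (\<Union>n<d. \<Union>(\<W> i n))"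
    by (elim bchoice[elim_format] exE)
  define \<Z> where "\<Z> n = {V \<inter> G i |V i. i \<in> I \<and> V \<in> \<W> i n}" for n
  show ?thesis
  proof (rule disjoint_refinementsI[where \<W>=\<Z>])
    fix n assume n: "n < d"
    show "pairwise disjnt (\<Z> n)"
      unfolding pairwise_def
    proof (intro ballI impI)
      fix S T assume "S \<in> \<Z> n" "T \<in> \<Z> n" "S \<noteq> T"
      then obtain V i V' j where *: "S = V \<inter> G i" "i \<in> I" "V \<in> \<W> i n" "T = V' \<inter> G j" "j \<in> I" "V' \<in> \<W> j n"
        unfolding \<Z>_def by blast
      show "disjnt S T"
      proof (cases "i = j")
        case True
        then have "V \<noteq> V'" using * \<open>S \<noteq> T\<close> by auto
        then have "disjnt V V'" using W n * True by (metis pairwiseD)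
        then show ?thesis using * by (auto simp: disjnt_iff)
      next
        case False
        then show ?thesis using disj * by (auto simp: disjnt_iff)
      qed
    qed
    fix S assume "S \<in> \<Z> n"
    then obtain V i where *: "S = V \<inter> G i" "i \<in> I" "V \<in> \<W> i n"
      unfolding \<Z>_def by blast
    then have "openin X V" "\<exists>U\<in>\<U>. V \<subseteq> U" using W n by auto
    then show "openin X S" "\<exists>U\<in>\<U>. S \<subseteq> U" using op * by auto
  next
    show "(\<Union>i\<in>I. A i) \<subseteq> (\<Union>n<d. \<Union>(\<Z> n))"
    proof
      fix x assume "x \<in> (\<Union>i\<in>I. A i)"
      then obtain i where i: "i \<in> I" "x \<in> A i" by blast
      moreover have "A i \<subseteq> (\<Union>n<d. \<Union>(\<W> i n))" using W i by blast
      ultimately obtain n V where nV: "n < d" "V \<in> \<W> i n" "x \<in> V" by blast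
      then have "V \<inter> G i \<in> \<Z> n" "x \<in> V \<inter> G i" using i AG unfolding \<Z>_def by auto
      then show "x \<in> (\<Union>n<d. \<Union>(\<Z> n))" using nV(1) by blast
    qed
  qed
qed

text \<open>A set inside the union of a disjoint family is cut by the members of that family into
  pieces that stay disjoint. So it is enough to refine the coarser cover by unions, which is finite
  in the application even if \<open>\<U>\<close> is not.\<close>

lemma disjoint_refinements_split:
  assumes "disjoint_refinements X d ((\<lambda>n. \<Union>(\<D> n)) ` M) A"
    and disj: "\<And>n. n \<in> M \<Longrightarrow> pairwise disjnt (\<D> n)"
    and op: "\<And>n D. n \<in> M \<Longrightarrow> D \<in> \<D> n \<Longrightarrow> openin X D"
    and ref: "\<And>n D. n \<in> M \<Longrightarrow> D \<in> \<D> n \<Longrightarrow> \<exists>U\<in>\<U>. D \<subseteq> U"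
  shows "disjoint_refinements X d \<U> A"
proof -
  obtain \<W> where W: "\<And>i. i < d \<Longrightarrow> pairwise disjnt (\<W> i)" "\<And>i V. i < d \<Longrightarrow> V \<in> \<W> i \<Longrightarrow> openin X V"
    "\<And>i V. i < d \<Longrightarrow> V \<in> \<W> i \<Longrightarrow> \<exists>U\<in>(\<lambda>n. \<Union>(\<D> n)) ` M. V \<subseteq> U" "A \<subseteq> (\<Union>i<d. \<Union>(\<W> i))"
    by (rule disjoint_refinementsE[OF assms(1)]) (rule that)
  define s where "s V = (SOME n. n \<in> M \<and> V \<subseteq> \<Union>(\<D> n))" for V
  have s: "s V \<in> M" "V \<subseteq> \<Union>(\<D> (s V))" if "i < d" "V \<in> \<W> i" for i V
  proof -
    have "\<exists>n. n \<in> M \<and> V \<subseteq> \<Union>(\<D> n)" using W(3)[OF that] by blast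
    then have "s V \<in> M \<and> V \<subseteq> \<Union>(\<D> (s V))" unfolding s_def by (rule someI_ex)
    then show "s V \<in> M" "V \<subseteq> \<Union>(\<D> (s V))" by auto
  qed
  define \<Z> where "\<Z> i = {V \<inter> D |V D. V \<in> \<W> i \<and> D \<in> \<D> (s V)}" for i
  show ?thesis
  proof (rule disjoint_refinementsI[where \<W>=\<Z>])
    fix i assume i: "i < d"
    show "pairwise disjnt (\<Z> i)"
      unfolding pairwise_def
    proof (intro ballI impI)
      fix S T assume "S \<in> \<Z> i" "T \<in> \<Z> i" "S \<noteq> T"
      then obtain V D V' D' where *: "S = V \<inter> D" "V \<in> \<W> i" "D \<in> \<D> (s V)"
          "T = V' \<inter> D'" "V' \<in> \<W> i" "D' \<in> \<D> (s V')"
        unfolding \<Z>_def by blast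
      show "disjnt S T"
      proof (cases "V = V'")
        case True
        then have "D \<noteq> D'" using * \<open>S \<noteq> T\<close> by auto
        then have "disjnt D D'"
          using disj[OF s(1)[OF i *(2)]] * True by (metis pairwiseD)
        then show ?thesis using * by (auto simp: disjnt_iff)
      next
        case False
        then have "disjnt V V'" using W(1)[OF i] * by (metis pairwiseD)
        then show ?thesis using * by (auto simp: disjnt_iff)
      qed
    qed
    fix S assume "S \<in> \<Z> i"
    then obtain V D where *: "S = V \<inter> D" "V \<in> \<W> i" "D \<in> \<D> (s V)"
      unfolding \<Z>_def by blast
    show "openin X S" using W(2)[OF i *(2)] op[OF s(1)[OF i *(2)] *(3)] * by auto
    show "\<exists>U\<in>\<U>. S \<subseteq> U" using ref[OF s(1)[OF i *(2)] *(3)] * by auto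
  next
    show "A \<subseteq> (\<Union>n<d. \<Union>(\<Z> n))"
    proof
      fix x assume "x \<in> A"
      then obtain i V where iV: "i < d" "V \<in> \<W> i" "x \<in> V" using W(4) by blast
      then obtain D where D: "D \<in> \<D> (s V)" "x \<in> D" using s(2)[OF iV(1,2)] by blast
      then have "V \<inter> D \<in> \<Z> i" "x \<in> V \<inter> D" using iV unfolding \<Z>_def by auto
      then show "x \<in> (\<Union>n<d. \<Union>(\<Z> n))" using iV(1) by blast
    qed
  qed
qed

section \<open>Disjoint families from bumps: open stars of barycentres\<close>

definition dominant_set :: "'a topology \<Rightarrow> 'i set \<Rightarrow> ('i \<Rightarrow> 'a \<Rightarrow> real) \<Rightarrow> 'i set \<Rightarrow> 'a set" where
  "dominant_set X I u J = {x \<in> topspace X. \<forall>i\<in>J. 0 < u i x \<and> (\<forall>j\<in>I - J. u j x < u i x)}"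

text \<open>Under the normalised bumps, \<open>dominant_set X I u J\<close> with \<open>J\<close>
  nonempty is the preimage of the open star of the barycentre of \<open>J\<close> in the barycentric
  subdivision. Cardinality \<open>Suc n\<close> keeps \<open>J\<close> nonempty, so each member lies
  in some \<open>U i\<close>.\<close>

definition dominant_family :: "'a topology \<Rightarrow> 'i set \<Rightarrow> ('i \<Rightarrow> 'a \<Rightarrow> real) \<Rightarrow> nat \<Rightarrow> 'a set set" where
  "dominant_family X I u n = dominant_set X I u ` {J. J \<subseteq> I \<and> finite J \<and> card J = Suc n}"

lemma openin_Collect_less:
  assumes "continuous_map X euclideanreal f" "continuous_map X euclideanreal g"
  shows "openin X {x \<in> topspace X. f x < g x}"
proof -
  have "openin X {x \<in> topspace X. g x - f x \<in> {0<..}}"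
    by (rule openin_continuous_map_preimage[OF continuous_map_diff[OF assms(2,1)]]) auto
  then show ?thesis by (simp cong: conj_cong)
qed

lemma openin_Collect_finite_ball:
  assumes "finite F" "\<And>i. i \<in> F \<Longrightarrow> openin X {x \<in> topspace X. P i x}"
  shows "openin X {x \<in> topspace X. \<forall>i\<in>F. P i x}"
  using assms
proof (induction F)
  case empty
  then show ?case by simp
next
  case (insert a F)
  have "openin X ({x \<in> topspace X. P a x} \<inter> {x \<in> topspace X. \<forall>i\<in>F. P i x})"
    using insert by (intro openin_Int) auto
  moreover have "{x \<in> topspace X. P a x} \<inter> {x \<in> topspace X. \<forall>i\<in>F. P i x} =
      {x \<in> topspace X. \<forall>i\<in>insert a F. P i x}" by auto
  ultimately show ?case by simp
qed

text \<open>There may be infinitely many \<open>j\<close> to compare with, but near a point all but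
  finitely many bumps vanish, and those are below \<open>u i\<close> as soon as \<open>u i\<close>
  is positive.\<close>

lemma openin_dominant_set:
  assumes u: "bump_family X I U u" and J: "J \<subseteq> I" "finite J"
  shows "openin X (dominant_set X I u J)"
proof (subst openin_subopen, intro ballI)
  fix x assume x: "x \<in> dominant_set X I u J"
  then have xX: "x \<in> topspace X" by (simp add: dominant_set_def)
  obtain N where N: "openin X N" "x \<in> N" and fin: "finite {i\<in>I. \<exists>y\<in>N. u i y \<noteq> 0}"
    using bump_familyD(6)[OF u xX] by blast
  define F where "F = {i\<in>I. \<exists>y\<in>N. u i y \<noteq> 0}"
  note uc = bump_familyD(1)[OF u]
  let ?T = "{x \<in> topspace X. \<forall>i\<in>J. 0 < u i x} \<inter>
     {x \<in> topspace X. \<forall>i\<in>J. \<forall>j\<in>F - J. u j x < u i x}"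
  have "openin X {x \<in> topspace X. \<forall>i\<in>J. 0 < u i x}"
    using J uc by (intro openin_Collect_finite_ball openin_Collect_less) auto
  moreover have "openin X {x \<in> topspace X. \<forall>j\<in>F - J. u j x < u i x}" if "i \<in> J" for i
    using J uc fin that unfolding F_def by (intro openin_Collect_finite_ball openin_Collect_less) auto
  then have "openin X {x \<in> topspace X. \<forall>i\<in>J. \<forall>j\<in>F - J. u j x < u i x}"
    by (rule openin_Collect_finite_ball[OF J(2)])
  ultimately have "openin X (N \<inter> ?T)" using N by auto
  moreover have "x \<in> N \<inter> ?T"
    using x N by (auto simp: dominant_set_def F_def)
  moreover have "N \<inter> ?T \<subseteq> dominant_set X I u J"
  proof
    fix y assume y: "y \<in> N \<inter> ?T"
    have "u j y < u i y" if "i \<in> J" "j \<in> I - J" for i j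
    proof (cases "j \<in> F")
      case True then show ?thesis using y that by blast
    next
      case False
      then have "u j y = 0" using y that by (auto simp: F_def)
      then show ?thesis using y that by auto
    qed
    then show "y \<in> dominant_set X I u J" using y by (auto simp: dominant_set_def)
  qed
  ultimately show "\<exists>T. openin X T \<and> x \<in> T \<and> T \<subseteq> dominant_set X I u J" by blast
qed

lemma dominant_set_subset:
  assumes "bump_family X I U u" "J \<subseteq> I" "i \<in> J"
  shows "dominant_set X I u J \<subseteq> U i"
proof
  fix x assume "x \<in> dominant_set X I u J"
  then have "x \<in> topspace X" "u i x \<noteq> 0" using assms(3) by (auto simp: dominant_set_def)
  then show "x \<in> U i" using bump_familyD(4)[OF assms(1)] assms by blast
qed

text \<open>Distinct finite sets of equal size each contain an index missing from the other; at a
  common point each of these two bumps would be smaller than the other.\<close>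

lemma disjnt_dominant_set:
  assumes "J \<subseteq> I" "J' \<subseteq> I" "finite J" "finite J'" "card J = card J'" "J \<noteq> J'"
  shows "disjnt (dominant_set X I u J) (dominant_set X I u J')"
proof -
  obtain i where i: "i \<in> J - J'" using assms by (metis Diff_eq_empty_iff all_not_in_conv card_subset_eq)
  obtain j where j: "j \<in> J' - J" using assms by (metis Diff_eq_empty_iff all_not_in_conv card_subset_eq)
  have False if "x \<in> dominant_set X I u J" "x \<in> dominant_set X I u J'" for x
  proof -
    have "u j x < u i x" "u i x < u j x"
      using that i j assms unfolding dominant_set_def by blast+
    then show False by simp
  qed
  then show ?thesis by (auto simp: disjnt_iff)
qed

lemma pairwise_disjnt_dominant_family: "pairwise disjnt (dominant_family X I u n)"
proof (rule pairwiseI)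
  fix S T assume "S \<in> dominant_family X I u n" "T \<in> dominant_family X I u n" "S \<noteq> T"
  then obtain J J' where "S = dominant_set X I u J" "J \<subseteq> I" "finite J" "card J = Suc n"
      "T = dominant_set X I u J'" "J' \<subseteq> I" "finite J'" "card J' = Suc n"
    unfolding dominant_family_def by auto
  with \<open>S \<noteq> T\<close> show "disjnt S T" using disjnt_dominant_set[of J I J' X u] by auto
qed

lemma dominant_familyD:
  assumes u: "bump_family X I U u" and D: "D \<in> dominant_family X I u n"
  shows "openin X D" "\<exists>i\<in>I. D \<subseteq> U i"
proof -
  obtain J where J: "D = dominant_set X I u J" "J \<subseteq> I" "finite J" "card J = Suc n"
    using D unfolding dominant_family_def by auto
  show "openin X D" using openin_dominant_set[OF u] J by simp
  have "J \<noteq> {}" using J by auto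
  then obtain i where "i \<in> J" by blast
  then show "\<exists>i\<in>I. D \<subseteq> U i" using dominant_set_subset[OF u J(2)] J by blast
qed

lemma peak_set:
  assumes u: "bump_family X I U u" and x: "x \<in> topspace X"
  defines "J \<equiv> {i\<in>I. u i x = 1}"
  shows "finite J" "0 < card J" "x \<in> dominant_set X I u J"
proof -
  show fin: "finite J"
    by (rule finite_subset[OF _ bump_family_finite_support[OF u x]]) (auto simp: J_def)
  have "J \<noteq> {}" using bump_familyD(5)[OF u x] unfolding J_def by blast
  then show "0 < card J" using fin by (simp add: card_gt_0_iff)
  have "u j x < 1" if "j \<in> I - J" for j
    using bump_familyD(3)[OF u _ x, of j] that by (force simp: J_def)
  then show "x \<in> dominant_set X I u J"
    using x by (auto simp: dominant_set_def J_def)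
qed

text \<open>The families indexed by \<open>card J - 1\<close> are disjoint, so a cover of multiplicity at most \<open>n\<close>
  has \<open>n\<close> disjoint refining families; an arbitrary cover still has countably many, and the sum of
  the bumps controls how many of them are needed near a point.\<close>
lemma peak_set_dominant_family:
  assumes u: "bump_family X I U u" and x: "x \<in> topspace X" and n: "card {i\<in>I. u i x = 1} \<le> n"
  shows "x \<in> (\<Union>i<n. \<Union>(dominant_family X I u i))"
proof -
  let ?J = "{i\<in>I. u i x = 1}"
  obtain k where k: "card ?J = Suc k" using peak_set(2)[OF u x] by (metis gr0_implies_Suc)
  then have "dominant_set X I u ?J \<in> dominant_family X I u k"
    using peak_set(1)[OF u x] unfolding dominant_family_def by (intro imageI) auto
  then show ?thesis using peak_set(3)[OF u x] k n by (intro UN_I[of k] UnionI) auto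
qed

lemma weighted_sum_one_dominant_family:
  assumes u: "bump_family X I U u" and x: "x \<in> topspace X"
    and n: "weighted_sum I (\<lambda>_. 1) u x \<le> real n"
  shows "x \<in> (\<Union>i<n. \<Union>(dominant_family X I u i))"
proof (rule peak_set_dominant_family[OF u x])
  have "real (card {i\<in>I. u i x = 1}) = sum (\<lambda>_. 1) {i\<in>I. u i x = 1}" by simp
  also have "\<dots> \<le> weighted_sum I (\<lambda>_. 1) u x"
    by (rule weighted_sum_ge_sum[OF u x]) auto
  finally show "card {i\<in>I. u i x = 1} \<le> n" using n by linarith
qed

section \<open>Separation of pairs of closed sets\<close>

text \<open>This bounds the covering dimension of \<open>A\<close> by \<open>d - 1\<close>, in the form of partitions between
  \<open>d\<close> pairs; only the traces on \<open>A\<close> have to be separated, so that pairs on different sets can be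
  glued.\<close>
definition separating_dim :: "'a topology \<Rightarrow> nat \<Rightarrow> 'a set \<Rightarrow> bool" where
  "separating_dim X d A \<longleftrightarrow>
     (\<forall>C D. (\<forall>i<d. closedin X (C i) \<and> closedin X (D i) \<and> disjnt (C i) (D i)) \<longrightarrow>
        (\<exists>V W. (\<forall>i<d. openin X (V i) \<and> openin X (W i) \<and> C i \<inter> A \<subseteq> V i \<and> D i \<inter> A \<subseteq> W i \<and>
                   disjnt (V i) (W i)) \<and>
               A \<subseteq> (\<Union>i<d. V i \<union> W i)))"

lemma separating_dimD:
  assumes "separating_dim X d A"
    and "\<forall>i<d. closedin X (C i) \<and> closedin X (D i) \<and> disjnt (C i) (D i)"
  shows "\<exists>V W. (\<forall>i<d. openin X (V i) \<and> openin X (W i) \<and> C i \<inter> A \<subseteq> V i \<and> D i \<inter> A \<subseteq> W i \<and>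
                   disjnt (V i) (W i)) \<and> A \<subseteq> (\<Union>i<d. V i \<union> W i)"
  by (rule mp[OF spec[OF spec[OF assms(1)[unfolded separating_dim_def], of C], of D] assms(2)])

lemma separating_dim_subset:
  assumes "separating_dim X d A" "B \<subseteq> A"
  shows "separating_dim X d B"
  unfolding separating_dim_def
proof (intro allI impI)
  fix C D :: "nat \<Rightarrow> 'a set"
  assume CD: "\<forall>i<d. closedin X (C i) \<and> closedin X (D i) \<and> disjnt (C i) (D i)"
  obtain V W where VW: "\<forall>i<d. openin X (V i) \<and> openin X (W i) \<and> C i \<inter> A \<subseteq> V i \<and> D i \<inter> A \<subseteq> W i \<and>
                   disjnt (V i) (W i)" "A \<subseteq> (\<Union>i<d. V i \<union> W i)"
    using separating_dimD[OF assms(1) CD] by (elim exE conjE)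
  have "\<forall>i<d. openin X (V i) \<and> openin X (W i) \<and> C i \<inter> B \<subseteq> V i \<and> D i \<inter> B \<subseteq> W i \<and>
                   disjnt (V i) (W i)"
    using VW(1) assms(2) by blast
  moreover have "B \<subseteq> (\<Union>i<d. V i \<union> W i)" using VW(2) assms(2) by (rule subset_trans[rotated])
  ultimately show "\<exists>V W. (\<forall>i<d. openin X (V i) \<and> openin X (W i) \<and> C i \<inter> B \<subseteq> V i \<and> D i \<inter> B \<subseteq> W i \<and>
                   disjnt (V i) (W i)) \<and> B \<subseteq> (\<Union>i<d. V i \<union> W i)"
    by (intro exI[of _ V] exI[of _ W] conjI)
qed

lemma finite_C_spaceD:
  assumes "finite_C_space X" "\<And>n::nat. finite_open_cover X (\<U> n)"
  shows "\<exists>k \<V>. (\<forall>n\<le>k. (\<forall>V\<in>\<V> n. openin X V \<and> (\<exists>U\<in>\<U> n. V \<subseteq> U)) \<and> pairwise disjnt (\<V> n)) \<and>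
           (\<Union>n\<le>k. \<Union>(\<V> n)) = topspace X"
  by (rule mp[OF spec[OF conjunct2[OF assms(1)[unfolded finite_C_space_def]], of \<U>]])
     (simp add: assms(2))

locale paracompact_normal =
  fixes X :: "'a topology"
  assumes paracompact: "paracompact_space X" and normal: "normal_space X"
begin

lemma bump_family_set_exists:
  assumes "\<And>U. U \<in> \<U> \<Longrightarrow> openin X U" "topspace X \<subseteq> \<Union>\<U>"
  shows "\<exists>u. bump_family X \<U> (\<lambda>U. U) u"
  using bump_family_exists[OF paracompact normal, of \<U> "\<lambda>U. U"] assms by auto

lemma closedin_peak:
  assumes "bump_family X I U u" "i \<in> I"
  shows "closedin X {x \<in> topspace X. u i x = 1}"
  using closedin_continuous_map_preimage[OF bump_familyD(1)[OF assms], of "{1}"] by simp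

text \<open>The pairs separated are the peak sets of all but one \<open>U i\<close>, \<open>i \<in> T\<close>, and the complements of
  these \<open>U i\<close>.\<close>
lemma shrink_one_intersection:
  assumes sep: "separating_dim X d A" and A: "closedin X A"
    and U: "\<And>i. i \<in> I \<Longrightarrow> openin X (U i)" and cov: "topspace X \<subseteq> (\<Union>i\<in>I. U i)"
    and T: "T \<subseteq> I" "finite T" "card T = Suc d"
  shows "\<exists>U'. (\<forall>i\<in>I. openin X (U' i) \<and> U' i \<subseteq> U i) \<and> topspace X \<subseteq> (\<Union>i\<in>I. U' i) \<and>
           A \<inter> (\<Inter>i\<in>T. U' i) = {}"
proof -
  obtain t where t: "t \<in> T" using T(3) by fastforce
  define T' where "T' = T - {t}"
  have T': "finite T'" "card T' = d" "T' \<subseteq> I" using T t by (auto simp: T'_def)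
  obtain h where h: "bij_betw h {..<d} T'"
    using ex_bij_betw_nat_finite[OF T'(1)] T'(2) by (auto simp: atLeast0LessThan)
  have hT: "h n \<in> T'" "h n \<in> I" if "n < d" for n
    using bij_betwE[OF h] that T'(3) by auto
  obtain u where u: "bump_family X I U u"
    using bump_family_exists[OF paracompact normal U cov] by blast
  define C where "C n = {x \<in> topspace X. u (h n) x = 1}" for n
  define D where "D n = topspace X - U (h n)" for n
  have CU: "C n \<subseteq> U (h n)" if "n < d" for n
    using bump_familyD(4)[OF u hT(2)[OF that]] by (auto simp: C_def)
  have CD: "\<forall>n<d. closedin X (C n) \<and> closedin X (D n) \<and> disjnt (C n) (D n)"
    using closedin_peak[OF u hT(2)] U[OF hT(2)] CU unfolding C_def D_def disjnt_def by blast
  obtain V W where VW: "\<forall>n<d. openin X (V n) \<and> openin X (W n) \<and> C n \<inter> A \<subseteq> V n \<and> D n \<inter> A \<subseteq> W n \<and>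
                   disjnt (V n) (W n)" and AVW: "A \<subseteq> (\<Union>n<d. V n \<union> W n)"
    using separating_dimD[OF sep CD] by (elim exE conjE)
  define k where "k = inv_into {..<d} h"
  have k: "k i < d" "h (k i) = i" if "i \<in> T'" for i
    using inv_into_into[of i h "{..<d}"] f_inv_into_f[of i h "{..<d}"] h that
    unfolding k_def bij_betw_def by auto
  have kh: "k (h n) = n" if "n < d" for n
    using h that unfolding k_def bij_betw_def by (simp add: inv_into_f_f)
  \<comment> \<open>On \<open>A\<close> the sets with index in \<open>T'\<close> are cut down to
    \<open>V\<close>, all others to the union of the \<open>W\<close>; off \<open>A\<close> nothing
    changes. A point of \<open>A\<close> in all sets of \<open>T\<close> would lie in some
    \<open>W n\<close> because of \<open>t\<close>, and in \<open>V n\<close> because of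
    \<open>h n\<close>.\<close>
  define U' where "U' i = (if i \<in> T' then (V (k i) \<inter> U i) \<union> (U i - A)
      else U i \<inter> ((\<Union>n<d. W n) \<union> (topspace X - A)))" for i
  show ?thesis
  proof (intro exI[of _ U'] conjI ballI)
    fix i assume i: "i \<in> I"
    show "U' i \<subseteq> U i" by (auto simp: U'_def)
    have UA: "openin X (U i - A)" using U[OF i] A by (rule openin_diff)
    have WA: "openin X ((\<Union>n<d. W n) \<union> (topspace X - A))"
      using VW A by (intro openin_Un openin_Union openin_diff) auto
    show "openin X (U' i)"
      using U[OF i] UA WA VW k by (auto simp: U'_def intro!: openin_Un openin_Int)
  next
    show "topspace X \<subseteq> (\<Union>i\<in>I. U' i)"
    proof
      fix x assume x: "x \<in> topspace X"
      obtain i where i: "i \<in> I" "u i x = 1" using bump_familyD(5)[OF u x] by blast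
      then have xU: "x \<in> U i" using bump_familyD(4)[OF u _ x] by simp
      show "x \<in> (\<Union>i\<in>I. U' i)"
      proof (cases "x \<in> A")
        case False
        then have "x \<in> U' i" using xU x by (auto simp: U'_def)
        then show ?thesis using i by blast
      next
        case xA: True
        show ?thesis
        proof (cases "i \<in> T'")
          case True
          then have "x \<in> C (k i)" using i x k by (auto simp: C_def)
          then have "x \<in> V (k i)" using VW k(1)[OF True] xA by blast
          then have "x \<in> U' i" using xU True by (auto simp: U'_def)
          then show ?thesis using i by blast
        next
          case False
          obtain n where n: "n < d" "x \<in> V n \<union> W n" using AVW xA by blast
          show ?thesis
          proof (cases "x \<in> W n")
            case True
            then have "x \<in> U' i" using xU False n by (auto simp: U'_def)
            then show ?thesis using i by blast
          next
            case notW: False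
            \<comment> \<open>The set with index \<open>h n\<close> takes over from \<open>i\<close>
              here: \<open>D n\<close> is the complement of \<open>U (h n)\<close>, and
              \<open>x\<close> is in \<open>V n\<close>.\<close>
            then have "x \<notin> D n" using VW n xA by blast
            then have "x \<in> U' (h n)" using n notW x hT[OF n(1)] kh[OF n(1)] by (auto simp: U'_def D_def)
            then show ?thesis using hT n by blast
          qed
        qed
      qed
    qed
  next
    show "A \<inter> (\<Inter>i\<in>T. U' i) = {}"
    proof (rule ccontr)
      assume "\<not> ?thesis"
      then obtain x where x: "x \<in> A" "\<And>i. i \<in> T \<Longrightarrow> x \<in> U' i" by blast
      have "x \<in> U' t" "t \<notin> T'" using x t by (auto simp: T'_def)
      then obtain n where n: "n < d" "x \<in> W n" using x(1) by (auto simp: U'_def)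
      have "h n \<in> T" using hT[OF n(1)] by (auto simp: T'_def)
      then have "x \<in> U' (h n)" using x(2) by blast
      then have "x \<in> V n" using hT[OF n(1)] kh[OF n(1)] x(1) by (auto simp: U'_def)
      then show False using VW n by (auto simp: disjnt_iff)
    qed
  qed
qed

text \<open>Further shrinking keeps empty intersections empty, so finitely many index sets are
  treated one after the other.\<close>

lemma shrink_intersections:
  assumes sep: "separating_dim X d A" and A: "closedin X A"
    and "finite \<T>" "\<And>T. T \<in> \<T> \<Longrightarrow> T \<subseteq> I \<and> finite T \<and> card T = Suc d"
    and "\<And>i. i \<in> I \<Longrightarrow> openin X (U i)" "topspace X \<subseteq> (\<Union>i\<in>I. U i)"
  shows "\<exists>U'. (\<forall>i\<in>I. openin X (U' i) \<and> U' i \<subseteq> U i) \<and> topspace X \<subseteq> (\<Union>i\<in>I. U' i) \<and>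
           (\<forall>T\<in>\<T>. A \<inter> (\<Inter>i\<in>T. U' i) = {})"
  using assms(3-)
proof (induction \<T>)
  case empty
  then show ?case by (intro exI[of _ U]) auto
next
  case (insert T \<T>)
  then obtain U' where U': "\<forall>i\<in>I. openin X (U' i) \<and> U' i \<subseteq> U i" "topspace X \<subseteq> (\<Union>i\<in>I. U' i)"
      "\<forall>T\<in>\<T>. A \<inter> (\<Inter>i\<in>T. U' i) = {}"
    by auto
  have "\<exists>U''. (\<forall>i\<in>I. openin X (U'' i) \<and> U'' i \<subseteq> U' i) \<and> topspace X \<subseteq> (\<Union>i\<in>I. U'' i) \<and>
           A \<inter> (\<Inter>i\<in>T. U'' i) = {}"
    by (rule shrink_one_intersection[OF sep A]) (use U' insert.prems in auto)
  then obtain U'' where U'': "\<forall>i\<in>I. openin X (U'' i) \<and> U'' i \<subseteq> U' i" "topspace X \<subseteq> (\<Union>i\<in>I. U'' i)"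
      "A \<inter> (\<Inter>i\<in>T. U'' i) = {}"
    by blast
  have "A \<inter> (\<Inter>i\<in>S. U'' i) = {}" if "S \<in> \<T>" for S
  proof -
    have "S \<subseteq> I" using insert.prems that by blast
    then have "(\<Inter>i\<in>S. U'' i) \<subseteq> (\<Inter>i\<in>S. U' i)" using U''(1) by (intro INF_mono) blast
    moreover have "A \<inter> (\<Inter>i\<in>S. U' i) = {}" using U'(3) that by (rule bspec)
    ultimately show ?thesis by auto
  qed
  moreover have "\<forall>i\<in>I. openin X (U'' i) \<and> U'' i \<subseteq> U i"
    using U''(1) U'(1) by blast
  ultimately show ?case using U''(2,3) by (intro exI[of _ U'']) auto
qed

text \<open>The complement of \<open>A\<close> completes the cover. After shrinking, no point of
  \<open>A\<close> lies in \<open>Suc d\<close> of the sets, so it has at most \<open>d\<close>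
  peaks and \<open>d\<close> dominant families cover \<open>A\<close>. Members meeting
  \<open>A\<close> do not lie in its complement, hence lie in a set of \<open>\<U>\<close>.
  Finiteness of \<open>\<U>\<close> makes the intersections to be destroyed finite in
  number.\<close>

lemma separating_dim_disjoint_refinements:
  assumes sep: "separating_dim X d A" and A: "closedin X A"
    and U: "finite \<U>" "\<And>U. U \<in> \<U> \<Longrightarrow> openin X U" "A \<subseteq> \<Union>\<U>"
  shows "disjoint_refinements X d \<U> A"
proof -
  let ?I = "insert (topspace X - A) \<U>"
  let ?T = "{T. T \<subseteq> ?I \<and> card T = Suc d}"
  have "\<exists>U'. (\<forall>i\<in>?I. openin X (U' i) \<and> U' i \<subseteq> i) \<and> topspace X \<subseteq> (\<Union>i\<in>?I. U' i) \<and>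
           (\<forall>T\<in>?T. A \<inter> (\<Inter>i\<in>T. U' i) = {})"
  proof (rule shrink_intersections[OF sep A])
    show "finite ?T" using U(1) by simp
    show "T \<subseteq> ?I \<and> finite T \<and> card T = Suc d" if "T \<in> ?T" for T
      using that U(1) by (auto intro: card_ge_0_finite)
    show "openin X i" if "i \<in> ?I" for i using that U(2) A by auto
    show "topspace X \<subseteq> (\<Union>i\<in>?I. i)" using U(3) by auto
  qed
  then obtain U' where U'0: "\<forall>i\<in>?I. openin X (U' i) \<and> U' i \<subseteq> i"
     "topspace X \<subseteq> (\<Union>i\<in>?I. U' i)" "\<forall>T\<in>?T. A \<inter> (\<Inter>i\<in>T. U' i) = {}"
    by (elim exE conjE)
  have U': "\<And>i. i \<in> ?I \<Longrightarrow> openin X (U' i)" "\<And>i. i \<in> ?I \<Longrightarrow> U' i \<subseteq> i"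
    using U'0(1) by auto
  obtain u where u: "bump_family X ?I U' u"
    using bump_family_exists[OF paracompact normal U'(1) U'0(2)] by blast
  show ?thesis
  proof (rule disjoint_refinementsI[where \<W>="\<lambda>n. {D \<in> dominant_family X ?I u n. D \<inter> A \<noteq> {}}"])
    fix n
    show "pairwise disjnt {D \<in> dominant_family X ?I u n. D \<inter> A \<noteq> {}}"
      by (rule pairwise_subset[OF pairwise_disjnt_dominant_family]) auto
    fix D assume D: "D \<in> {D \<in> dominant_family X ?I u n. D \<inter> A \<noteq> {}}"
    then show "openin X D" using dominant_familyD[OF u] by blast
    have "D \<in> dominant_family X ?I u n" using D by simp
    from dominant_familyD(2)[OF u this] obtain i where "i \<in> ?I" "D \<subseteq> U' i" by blast
    then have i: "i \<in> ?I" "D \<subseteq> i" using U'(2) by auto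
    then have "i \<noteq> topspace X - A" using D by blast
    then show "\<exists>U\<in>\<U>. D \<subseteq> U" using i by blast
  next
    show "A \<subseteq> (\<Union>n<d. \<Union>{D \<in> dominant_family X ?I u n. D \<inter> A \<noteq> {}})"
    proof
      fix x assume xA: "x \<in> A"
      then have x: "x \<in> topspace X" using A closedin_subset by blast
      let ?J = "{i\<in>?I. u i x = 1}"
      have "card ?J \<le> d"
      proof (rule ccontr)
        assume "\<not> ?thesis"
        then have "Suc d \<le> card ?J" by simp
        then obtain T where T: "T \<subseteq> ?J" "card T = Suc d"
          by (rule obtain_subset_with_card_n)
        then have "T \<in> ?T" by blast
        moreover have "x \<in> U' i" if "i \<in> T" for i
          using bump_familyD(4)[OF u _ x, of i] T(1) that by auto
        ultimately show False using bspec[OF U'0(3), of T] xA by blast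
      qed
      then have "x \<in> (\<Union>n<d. \<Union>(dominant_family X ?I u n))"
        by (rule peak_set_dominant_family[OF u x])
      then show "x \<in> (\<Union>n<d. \<Union>{D \<in> dominant_family X ?I u n. D \<inter> A \<noteq> {}})"
        using xA by blast
    qed
  qed
qed

text \<open>The property is applied to the covers by the complements of \<open>C n\<close> and
  \<open>D n\<close>. \<open>P n\<close> collects the members meeting \<open>C n\<close>, which
  therefore miss \<open>D n\<close>, and \<open>Q n\<close> the others. The peak sets
  \<open>F n\<close> are a closed shrinking of the unions; each is divided between
  \<open>P n\<close> and \<open>Q n\<close> and added to the pair. Normality separates the enlarged
  pairs, and the \<open>F n\<close> cover \<open>X\<close>.\<close>

lemma finite_C_space_pairs:
  assumes fC: "finite_C_space X"
    and CD: "\<And>i::nat. closedin X (C i) \<and> closedin X (D i) \<and> disjnt (C i) (D i)"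
  shows "\<exists>k V W. (\<forall>i\<le>k. openin X (V i) \<and> openin X (W i) \<and> C i \<subseteq> V i \<and> D i \<subseteq> W i \<and> disjnt (V i) (W i)) \<and>
           topspace X \<subseteq> (\<Union>i\<le>k. V i \<union> W i)"
proof -
  have foc: "finite_open_cover X {topspace X - C n, topspace X - D n}" for n
    using CD[of n] by (auto simp: finite_open_cover_def disjnt_iff)
  obtain k \<V> where V0: "\<forall>n\<le>k. (\<forall>V\<in>\<V> n. openin X V \<and>
         (\<exists>U\<in>{topspace X - C n, topspace X - D n}. V \<subseteq> U)) \<and> pairwise disjnt (\<V> n)"
     and cov: "(\<Union>n\<le>k. \<Union>(\<V> n)) = topspace X"
    using finite_C_spaceD[where \<U>="\<lambda>n. {topspace X - C n, topspace X - D n}", OF fC foc] by (elim exE conjE)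
  have V: "(\<forall>V\<in>\<V> n. openin X V \<and> (\<exists>U\<in>{topspace X - C n, topspace X - D n}. V \<subseteq> U)) \<and>
      pairwise disjnt (\<V> n)" if "n \<le> k" for n
    using V0 that by (elim allE impE)
  obtain u where u: "bump_family X {..k} (\<lambda>n. \<Union>(\<V> n)) u"
  proof -
    have "openin X (\<Union>(\<V> n))" if "n \<in> {..k}" for n using V that by blast
    moreover have "topspace X \<subseteq> (\<Union>n\<in>{..k}. \<Union>(\<V> n))" using cov by simp
    ultimately have "\<exists>u. bump_family X {..k} (\<lambda>n. \<Union>(\<V> n)) u"
      by (rule bump_family_exists[OF paracompact normal])
    then show thesis using that by blast
  qed
  define F where "F n = {x \<in> topspace X. u n x = 1}" for n
  define P where "P n = \<Union>{V\<in>\<V> n. V \<inter> C n \<noteq> {}}" for n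
  define Q where "Q n = \<Union>{V\<in>\<V> n. V \<inter> C n = {}}" for n
  have PQ0: "P n \<inter> Q n = {}" if "n \<le> k" for n
  proof (rule ccontr)
    assume "P n \<inter> Q n \<noteq> {}"
    then obtain x V V' where *: "V \<in> \<V> n" "V \<inter> C n \<noteq> {}" "V' \<in> \<V> n" "V' \<inter> C n = {}" "x \<in> V" "x \<in> V'"
      unfolding P_def Q_def by blast
    then have "V \<noteq> V'" by blast
    then have "disjnt V V'" using pairwiseD[of disjnt "\<V> n" V V'] V[OF that] * by simp
    then show False using * by (auto simp: disjnt_iff)
  qed
  have ex: "\<exists>V W. openin X V \<and> openin X W \<and> C n \<union> (F n - Q n) \<subseteq> V \<and> D n \<union> (F n - P n) \<subseteq> W \<and> disjnt V W"
    if n: "n \<le> k" for n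
  proof -
    have "F n \<subseteq> \<Union>(\<V> n)"
      using bump_familyD(4)[OF u, of n] n by (auto simp: F_def)
    moreover have "\<Union>(\<V> n) = P n \<union> Q n" unfolding P_def Q_def by blast
    ultimately have F: "closedin X (F n)" "F n \<subseteq> P n \<union> Q n"
      using closedin_peak[OF u, of n] n by (auto simp: F_def)
    have PQ: "openin X (P n)" "openin X (Q n)" using V[OF n] by (auto simp: P_def Q_def)
    have "P n \<inter> D n = {}" "Q n \<inter> C n = {}"
      using V[OF n] by (auto simp: P_def Q_def)
    moreover note PQ0[OF n]
    ultimately have "disjnt (C n \<union> (F n - Q n)) (D n \<union> (F n - P n))"
      using CD[of n] F(2) by (auto simp: disjnt_iff)
    moreover have "closedin X (C n \<union> (F n - Q n))" "closedin X (D n \<union> (F n - P n))"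
      using CD[of n] F(1) PQ by (auto intro!: closedin_Un closedin_diff)
    ultimately show ?thesis
      by (intro normal[unfolded normal_space_def, rule_format] conjI)
  qed
  then obtain V W where VW: "\<And>n. n \<le> k \<Longrightarrow> openin X (V n) \<and> openin X (W n) \<and> C n \<union> (F n - Q n) \<subseteq> V n \<and>
      D n \<union> (F n - P n) \<subseteq> W n \<and> disjnt (V n) (W n)"
    by metis
  have "topspace X \<subseteq> (\<Union>i\<le>k. V i \<union> W i)"
  proof
    fix x assume x: "x \<in> topspace X"
    then obtain n where n: "n \<le> k" "x \<in> F n"
      using bump_familyD(5)[OF u x] by (auto simp: F_def)
    then have "x \<in> V n \<union> W n" using VW[OF n(1)] PQ0[OF n(1)] by blast
    then show "x \<in> (\<Union>i\<le>k. V i \<union> W i)" using n by blast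
  qed
  moreover have "\<forall>i\<le>k. openin X (V i) \<and> openin X (W i) \<and> C i \<subseteq> V i \<and> D i \<subseteq> W i \<and> disjnt (V i) (W i)"
    using VW by simp
  ultimately show ?thesis by (intro exI[of _ k] exI[of _ V] exI[of _ W] conjI)
qed

end

section \<open>Arbitrary open covers of finite C-spaces\<close>

definition refinable :: "'a topology \<Rightarrow> nat \<Rightarrow> 'a set \<Rightarrow> bool" where
  "refinable X d A \<longleftrightarrow>
     (\<forall>\<U>. (\<forall>U\<in>\<U>. openin X U) \<and> topspace X \<subseteq> \<Union>\<U> \<longrightarrow> disjoint_refinements X d \<U> A)"

lemma refinableD:
  assumes "refinable X d A" "\<forall>U\<in>\<U>. openin X U" "topspace X \<subseteq> \<Union>\<U>"
  shows "disjoint_refinements X d \<U> A"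
  by (rule mp[OF spec[OF assms(1)[unfolded refinable_def], of \<U>] conjI[OF assms(2,3)]])

lemma refinableI:
  assumes "\<And>\<U>. \<forall>U\<in>\<U>. openin X U \<Longrightarrow> topspace X \<subseteq> \<Union>\<U> \<Longrightarrow> disjoint_refinements X d \<U> A"
  shows "refinable X d A"
  unfolding refinable_def by (intro allI impI, elim conjE, rule assms)

lemma refinable_subset:
  assumes "refinable X d A" "B \<subseteq> A"
  shows "refinable X d B"
  by (rule refinableI, rule disjoint_refinements_subset[OF refinableD[OF assms(1)] assms(2)])

lemma refinable_mono:
  assumes "refinable X d A" "d \<le> e"
  shows "refinable X e A"
  by (rule refinableI, rule disjoint_refinements_mono[OF refinableD[OF assms(1)] assms(2)])

lemma refinable_Un:
  assumes "refinable X d A" "refinable X e B"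
  shows "refinable X (d + e) (A \<union> B)"
  by (rule refinableI, rule disjoint_refinements_Un[OF refinableD[OF assms(1)] refinableD[OF assms(2)]])

text \<open>\<open>f\<close> is locally bounded above, so near a point only finitely many
  \<open>C d\<close> occur.\<close>

lemma closedin_UN_unbounded:
  assumes f: "continuous_map X euclideanreal f"
    and C: "\<And>d::nat. d \<in> M \<Longrightarrow> closedin X (C d)" "\<And>d x. d \<in> M \<Longrightarrow> x \<in> C d \<Longrightarrow> real d \<le> f x"
  shows "closedin X (\<Union>d\<in>M. C d)"
proof (rule closedin_locally_finite_Union)
  show "closedin X S" if "S \<in> C ` M" for S using that C by blast
  show "locally_finite_in X (C ` M)"
    unfolding locally_finite_in_def
  proof (intro conjI ballI)
    show "\<Union>(C ` M) \<subseteq> topspace X" using C(1) closedin_subset by blast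
    fix x assume x: "x \<in> topspace X"
    define N where "N = {y \<in> topspace X. f y < f x + 1}"
    have "openin X N" unfolding N_def
      using f by (intro openin_Collect_less) auto
    moreover have "x \<in> N" using x by (simp add: N_def)
    moreover have "{S \<in> C ` M. S \<inter> N \<noteq> {}} \<subseteq> C ` {d. d \<le> nat \<lceil>f x + 1\<rceil>}"
    proof
      fix S assume "S \<in> {S \<in> C ` M. S \<inter> N \<noteq> {}}"
      then obtain d y where d: "d \<in> M" "S = C d" "y \<in> C d" "y \<in> N" by blast
      then have "real d < f x + 1" using C(2) by (fastforce simp: N_def)
      then have "d \<le> nat \<lceil>f x + 1\<rceil>" by linarith
      then show "S \<in> C ` {d. d \<le> nat \<lceil>f x + 1\<rceil>}" using d by blast
    qed
    then have "finite {S \<in> C ` M. S \<inter> N \<noteq> {}}"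
      by (rule finite_subset) simp
    ultimately show "\<exists>V. openin X V \<and> x \<in> V \<and> finite {S \<in> C ` M. S \<inter> V \<noteq> {}}" by blast
  qed
qed

context paracompact_normal
begin

section \<open>Dimension of the strips of a real function\<close>

definition strip :: "('a \<Rightarrow> real) \<Rightarrow> nat \<Rightarrow> 'a set" where
  "strip f n = {x \<in> topspace X. real n \<le> f x \<and> f x \<le> real n + 1}"

lemma closedin_strip:
  assumes "continuous_map X euclideanreal f"
  shows "closedin X (strip f n)"
  using closedin_continuous_map_preimage[OF assms, of "{real n..real n + 1}"]
  by (simp add: strip_def)

text \<open>Otherwise there are pairwise disjoint strips \<open>p d\<close>, each with
  \<open>d\<close> pairs that cannot be separated as required on it. Gluing the \<open>i\<close>-th
  pairs of all strips gives one sequence of closed pairs; with \<open>k\<close> from the finite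
  C-property, the strip for \<open>Suc k\<close> yields the contradiction.\<close>

lemma strips_separating_dim:
  assumes fC: "finite_C_space X" and f: "continuous_map X euclideanreal f"
  shows "\<exists>N d. \<forall>n\<ge>N. separating_dim X d (strip f n)"
proof (rule ccontr)
  assume "\<not> ?thesis"
  then have "\<forall>N d. \<exists>n. n \<ge> N \<and> \<not> separating_dim X d (strip f n)" by blast
  then obtain q where q: "\<And>N d. q N d \<ge> N" "\<And>N d. \<not> separating_dim X d (strip f (q N d))"
    by metis
  \<comment> \<open>Steps of at least 2, because neighbouring strips share a level set of
    \<open>f\<close>.\<close>
  define p where "p = rec_nat (q 0 0) (\<lambda>d n. q (n + 2) (Suc d))"
  have p_Suc: "p (Suc d) = q (p d + 2) (Suc d)" for d by (simp add: p_def)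
  have p_sep: "\<not> separating_dim X d (strip f (p d))" for d
    by (cases d) (use q(2) p_Suc in \<open>auto simp: p_def\<close>)
  have p_step: "p d + 2 \<le> p (Suc d)" for d using q(1) by (simp add: p_Suc)
  have p_less: "p d + 2 \<le> p e" if "d < e" for d e
    using that
  proof (induction e)
    case (Suc e)
    then show ?case using p_step[of e] by (cases "d = e") auto
  qed simp
  have p_ge: "d \<le> p d" for d
  proof (induction d)
    case (Suc d)
    then show ?case using p_step[of d] by simp
  qed simp
  have disj: "d = e" if "x \<in> strip f (p d)" "x \<in> strip f (p e)" for d e x
  proof (rule ccontr)
    assume "d \<noteq> e"
    then consider "p d + 2 \<le> p e" | "p e + 2 \<le> p d" using p_less by (meson linorder_neqE_nat)
    then show False using that by cases (auto simp: strip_def)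
  qed
  have "\<forall>d. \<exists>CD. (\<forall>i<d. closedin X (fst CD i) \<and> closedin X (snd CD i) \<and> disjnt (fst CD i) (snd CD i)) \<and>
     \<not> (\<exists>V W. (\<forall>i<d. openin X (V i) \<and> openin X (W i) \<and> fst CD i \<inter> strip f (p d) \<subseteq> V i \<and>
            snd CD i \<inter> strip f (p d) \<subseteq> W i \<and> disjnt (V i) (W i)) \<and>
          strip f (p d) \<subseteq> (\<Union>i<d. V i \<union> W i))"
    using p_sep unfolding separating_dim_def by (simp add: split_paired_Ex)
  then obtain CD where CD: "\<forall>d. (\<forall>i<d. closedin X (fst (CD d) i) \<and> closedin X (snd (CD d) i) \<and>
          disjnt (fst (CD d) i) (snd (CD d) i)) \<and>
     \<not> (\<exists>V W. (\<forall>i<d. openin X (V i) \<and> openin X (W i) \<and> fst (CD d) i \<inter> strip f (p d) \<subseteq> V i \<and>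
            snd (CD d) i \<inter> strip f (p d) \<subseteq> W i \<and> disjnt (V i) (W i)) \<and>
          strip f (p d) \<subseteq> (\<Union>i<d. V i \<union> W i))"
    by (elim choice[elim_format] exE)
  \<comment> \<open>The strip for \<open>d\<close> has pairs only for \<open>i < d\<close>, so the
    \<open>i\<close>-th pairs are glued over \<open>d > i\<close>.\<close>
  define C where "C i = (\<Union>d\<in>{i<..}. fst (CD d) i \<inter> strip f (p d))" for i
  define D where "D i = (\<Union>d\<in>{i<..}. snd (CD d) i \<inter> strip f (p d))" for i
  have strip_ge: "real d \<le> f x" if "x \<in> strip f (p d)" for d x
    using that p_ge[of d] by (auto simp: strip_def)
  have "closedin X (C i) \<and> closedin X (D i) \<and> disjnt (C i) (D i)" for i
  proof (intro conjI)
    show "closedin X (C i)"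
      unfolding C_def using CD closedin_strip[OF f] strip_ge
      by (intro closedin_UN_unbounded[OF f]) auto
    show "closedin X (D i)"
      unfolding D_def using CD closedin_strip[OF f] strip_ge
      by (intro closedin_UN_unbounded[OF f]) auto
    show "disjnt (C i) (D i)"
      unfolding disjnt_iff
    proof (intro allI notI)
      fix x assume "x \<in> C i \<and> x \<in> D i"
      then obtain d e where d: "i < d" "x \<in> fst (CD d) i" "x \<in> strip f (p d)"
        and e: "i < e" "x \<in> snd (CD e) i" "x \<in> strip f (p e)"
        unfolding C_def D_def by blast
      have "d = e" using d e disj by blast
      then show False using d e CD by (auto simp: disjnt_iff)
    qed
  qed
  then have "\<exists>k V W. (\<forall>i\<le>k. openin X (V i) \<and> openin X (W i) \<and> C i \<subseteq> V i \<and> D i \<subseteq> W i \<and> disjnt (V i) (W i)) \<and>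
           topspace X \<subseteq> (\<Union>i\<le>k. V i \<union> W i)"
    by (rule finite_C_space_pairs[OF fC])
  then obtain k V W where VW: "\<forall>i\<le>k. openin X (V i) \<and> openin X (W i) \<and> C i \<subseteq> V i \<and> D i \<subseteq> W i \<and>
      disjnt (V i) (W i)" and cov: "topspace X \<subseteq> (\<Union>i\<le>k. V i \<union> W i)"
    by (elim exE conjE)
  \<comment> \<open>The indices up to \<open>k\<close> number exactly the \<open>Suc k\<close> pairs
    of this strip.\<close>
  let ?d = "Suc k"
  have sub: "fst (CD ?d) i \<inter> strip f (p ?d) \<subseteq> C i" "snd (CD ?d) i \<inter> strip f (p ?d) \<subseteq> D i" if "i < ?d" for i
    using that unfolding C_def D_def by blast+
  have "\<forall>i<?d. openin X (V i) \<and> openin X (W i) \<and> fst (CD ?d) i \<inter> strip f (p ?d) \<subseteq> V i \<and>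
            snd (CD ?d) i \<inter> strip f (p ?d) \<subseteq> W i \<and> disjnt (V i) (W i)"
  proof (intro allI impI)
    fix i assume i: "i < ?d"
    then have "openin X (V i) \<and> openin X (W i) \<and> C i \<subseteq> V i \<and> D i \<subseteq> W i \<and> disjnt (V i) (W i)"
      using VW by simp
    then show "openin X (V i) \<and> openin X (W i) \<and> fst (CD ?d) i \<inter> strip f (p ?d) \<subseteq> V i \<and>
            snd (CD ?d) i \<inter> strip f (p ?d) \<subseteq> W i \<and> disjnt (V i) (W i)"
      using sub[OF i] by auto
  qed
  moreover have "strip f (p ?d) \<subseteq> (\<Union>i<?d. V i \<union> W i)"
    using cov unfolding lessThan_Suc_atMost by (auto simp: strip_def)
  ultimately show False using CD by blast
qed

lemma mem_strip:
  assumes "x \<in> topspace X" "0 \<le> f x"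
  shows "x \<in> strip f (nat \<lfloor>f x\<rfloor>)"
  using assms by (simp add: strip_def)

text \<open>The margin 1/2 is the largest for which the open thickenings for \<open>n\<close> and
  \<open>n + 2\<close> stay disjoint.\<close>

definition wide_strip :: "('a \<Rightarrow> real) \<Rightarrow> nat \<Rightarrow> 'a set" where
  "wide_strip f n = {x \<in> topspace X. real n - 1/2 < f x} \<inter> {x \<in> topspace X. f x < real n + 3/2}"

lemma openin_wide_strip:
  assumes "continuous_map X euclideanreal f"
  shows "openin X (wide_strip f n)"
  unfolding wide_strip_def using assms by (intro openin_Int openin_Collect_less) auto

lemma disjnt_wide_strip:
  assumes "n \<noteq> m" "n mod 2 = m mod 2"
  shows "disjnt (wide_strip f n) (wide_strip f m)"
proof -
  have "m \<noteq> Suc n" "n \<noteq> Suc m" using assms(2) by (auto simp: mod_Suc split: if_splits)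
  then have "n + 2 \<le> m \<or> m + 2 \<le> n" using assms(1) by linarith
  then show ?thesis by (auto simp: disjnt_iff wide_strip_def)
qed

text \<open>For a given cover, the sum \<open>s\<close> of its bumps is cut into strips as well. On
  strip \<open>j\<close> of \<open>s\<close> the first \<open>j + 1\<close> dominant families
  suffice; their unions form a finite cover, so the dimension of strip \<open>n\<close> of
  \<open>f\<close> yields \<open>d\<close> families whatever \<open>j\<close> is. Cells of equal
  parities lie in disjoint open sets and share their families, whence \<open>4 * d\<close>,
  independent of the cover.\<close>

lemma refinable_superlevel:
  assumes fC: "finite_C_space X" and f: "continuous_map X euclideanreal f"
  shows "\<exists>N d. refinable X d {x \<in> topspace X. real N \<le> f x}"
proof -
  obtain N d where Nd: "\<And>n. n \<ge> N \<Longrightarrow> separating_dim X d (strip f n)"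
    using strips_separating_dim[OF fC f] by blast
  have "disjoint_refinements X (4 * d) \<U> {x \<in> topspace X. real N \<le> f x}"
    if \<U>: "\<And>U. U \<in> \<U> \<Longrightarrow> openin X U" "topspace X \<subseteq> \<Union>\<U>" for \<U>
  proof -
    obtain u where u: "bump_family X \<U> (\<lambda>U. U) u"
      using bump_family_set_exists[OF \<U>] by blast
    define s where "s = weighted_sum \<U> (\<lambda>_. 1) u"
    have s: "continuous_map X euclideanreal s"
      unfolding s_def by (rule continuous_map_weighted_sum[OF u])
    have s0: "0 \<le> s x" if "x \<in> topspace X" for x
      using weighted_sum_ge_sum[OF u that, of "\<lambda>_. 1" "{}"] by (simp add: s_def)
    have cell: "disjoint_refinements X d \<U> (strip f n \<inter> strip s j)" if n: "n \<ge> N" for n j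
    proof (rule disjoint_refinements_split[where \<D>="dominant_family X \<U> u" and M="{..<Suc j}"])
      show "disjoint_refinements X d ((\<lambda>n. \<Union>(dominant_family X \<U> u n)) ` {..<Suc j}) (strip f n \<inter> strip s j)"
      proof (rule separating_dim_disjoint_refinements)
        show "separating_dim X d (strip f n \<inter> strip s j)"
          by (rule separating_dim_subset[OF Nd[OF n]]) auto
        show "closedin X (strip f n \<inter> strip s j)"
          using closedin_strip f s by blast
        show "openin X U" if "U \<in> (\<lambda>n. \<Union>(dominant_family X \<U> u n)) ` {..<Suc j}" for U
          using that dominant_familyD(1)[OF u] by blast
        show "strip f n \<inter> strip s j \<subseteq> \<Union>((\<lambda>n. \<Union>(dominant_family X \<U> u n)) ` {..<Suc j})"
        proof
          fix x assume x: "x \<in> strip f n \<inter> strip s j"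
          then have "weighted_sum \<U> (\<lambda>_. 1) u x \<le> real (Suc j)" by (simp add: strip_def s_def)
          then show "x \<in> \<Union>((\<lambda>n. \<Union>(dominant_family X \<U> u n)) ` {..<Suc j})"
            using x by (intro weighted_sum_one_dominant_family[OF u]) (auto simp: strip_def)
        qed
      qed simp
      show "pairwise disjnt (dominant_family X \<U> u n)" for n
        by (rule pairwise_disjnt_dominant_family)
      show "openin X D" "\<exists>U\<in>\<U>. D \<subseteq> U" if "D \<in> dominant_family X \<U> u n" for D n
        using dominant_familyD[OF u that] by auto
    qed
    \<comment> \<open>A code \<open>c\<close> below 4 holds the parities of \<open>n\<close> and
      \<open>j\<close> as its binary digits.\<close>
    define I where "I c = {(n, j). N \<le> n \<and> n mod 2 = c div 2 \<and> j mod 2 = c mod 2}" for c :: nat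
    define Q where "Q c = (\<Union>(n,j)\<in>I c. strip f n \<inter> strip s j)" for c
    have "disjoint_refinements X d \<U> (Q c)" for c
      unfolding Q_def
    proof (rule disjoint_refinements_disjoint_UN[where G="\<lambda>(n,j). wide_strip f n \<inter> wide_strip s j"])
      fix a assume a: "a \<in> I c"
      show "openin X (case a of (n, j) \<Rightarrow> wide_strip f n \<inter> wide_strip s j)"
        using openin_wide_strip[OF f] openin_wide_strip[OF s] by (auto split: prod.split)
      show "(case a of (n, j) \<Rightarrow> strip f n \<inter> strip s j) \<subseteq> (case a of (n, j) \<Rightarrow> wide_strip f n \<inter> wide_strip s j)"
        by (auto simp: strip_def wide_strip_def split: prod.split)
      show "disjoint_refinements X d \<U> (case a of (n, j) \<Rightarrow> strip f n \<inter> strip s j)"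
        using cell a by (auto simp: I_def)
      fix b assume b: "b \<in> I c" "a \<noteq> b"
      obtain n j m i where ab: "a = (n, j)" "b = (m, i)" by (metis surj_pair)
      have par: "n mod 2 = m mod 2" "j mod 2 = i mod 2" using a b ab by (auto simp: I_def)
      have "n \<noteq> m \<or> j \<noteq> i" using b ab by auto
      then have "disjnt (wide_strip f n) (wide_strip f m) \<or> disjnt (wide_strip s j) (wide_strip s i)"
        using disjnt_wide_strip par by blast
      then show "disjnt (case a of (n, j) \<Rightarrow> wide_strip f n \<inter> wide_strip s j)
           (case b of (n, j) \<Rightarrow> wide_strip f n \<inter> wide_strip s j)"
        using ab by (auto simp: disjnt_iff)
    qed
    then have "disjoint_refinements X (4 * d) \<U> (\<Union>c<4. Q c)"
      by (rule disjoint_refinements_UN_lessThan)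
    then show ?thesis
    proof (rule disjoint_refinements_subset)
      show "{x \<in> topspace X. real N \<le> f x} \<subseteq> (\<Union>c<4. Q c)"
      proof
        fix x assume x: "x \<in> {x \<in> topspace X. real N \<le> f x}"
        define n j where "n = nat \<lfloor>f x\<rfloor>" and "j = nat \<lfloor>s x\<rfloor>"
        have "0 \<le> f x" using x by (auto intro: order_trans[of _ "real N"])
        then have "x \<in> strip f n \<inter> strip s j"
          unfolding n_def j_def using mem_strip[of x f] mem_strip[of x s] s0 x by auto
        moreover have "N \<le> n" using x by (simp add: n_def) linarith
        moreover define c where "c = 2 * (n mod 2) + j mod 2"
        moreover have "c < 4" "n mod 2 = c div 2" "j mod 2 = c mod 2" 
          unfolding c_def using mod_less_divisor[of 2 n] mod_less_divisor[of 2 j] by auto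
        ultimately show "x \<in> (\<Union>c<4. Q c)"
          unfolding Q_def I_def by (intro UN_I[of c] UN_I[of "(n, j)"]) auto
      qed
    qed
  qed
  then have "refinable X (4 * d) {x \<in> topspace X. real N \<le> f x}"
    by (intro refinableI) blast
  then show ?thesis by blast
qed

text \<open>The core is compact, and everything away from it is finite-dimensional.\<close>
definition core :: "'a set" where
  "core = {x \<in> topspace X. \<nexists>W d. openin X W \<and> x \<in> W \<and> refinable X d W}"

text \<open>The members whose bump peaks at a point of \<open>core\<close> suffice. If there were
  infinitely many, weights growing along them would give a continuous function exceeding every bound
  at some core point, and a refinable superlevel set would be a neighbourhood of that point.\<close>

lemma finite_subcover_core:
  assumes fC: "finite_C_space X" and \<U>: "\<And>U. U \<in> \<U> \<Longrightarrow> openin X U" "topspace X \<subseteq> \<Union>\<U>"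
  shows "\<exists>\<F>. finite \<F> \<and> \<F> \<subseteq> \<U> \<and> core \<subseteq> \<Union>\<F>"
proof -
  obtain u where u: "bump_family X \<U> (\<lambda>U. U) u"
    using bump_family_set_exists[OF \<U>] by blast
  define \<F> where "\<F> = {U\<in>\<U>. \<exists>x\<in>core. u U x = 1}"
  have coreX: "core \<subseteq> topspace X" by (auto simp: core_def)
  have "core \<subseteq> \<Union>\<F>"
  proof
    fix x assume x: "x \<in> core"
    then have xX: "x \<in> topspace X" using coreX by blast
    obtain U where U: "U \<in> \<U>" "u U x = 1" using bump_familyD(5)[OF u xX] by blast
    then have "x \<in> U" using bump_familyD(4)[OF u _ xX] by simp
    then show "x \<in> \<Union>\<F>" using U x by (auto simp: \<F>_def)
  qed
  moreover have "finite \<F>"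
  proof (rule ccontr)
    assume "infinite \<F>"
    then obtain h :: "nat \<Rightarrow> 'a set" where h: "inj h" "range h \<subseteq> \<F>"
      using infinite_countable_subset by blast
    \<comment> \<open>a continuous function that is unbounded on the core, although its superlevel sets are eventually refinable\<close>
    define c where "c U = (if U \<in> range h then real (inv h U) else 0)" for U
    define f where "f = weighted_sum \<U> c u"
    have f: "continuous_map X euclideanreal f"
      unfolding f_def by (rule continuous_map_weighted_sum[OF u])
    obtain N d where N: "refinable X d {x \<in> topspace X. real N \<le> f x}"
      using refinable_superlevel[OF fC f] by blast
    have "h (Suc N) \<in> \<F>" using h(2) by blast
    then obtain x where x: "x \<in> core" "u (h (Suc N)) x = 1" "h (Suc N) \<in> \<U>"
      by (auto simp: \<F>_def)
    then have xX: "x \<in> topspace X" using coreX by blast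
    have "sum c {h (Suc N)} \<le> f x"
      unfolding f_def by (rule weighted_sum_ge_sum[OF u xX]) (use x in \<open>auto simp: c_def\<close>)
    then have "real (Suc N) \<le> f x" using h(1) by (simp add: c_def)
    let ?W = "{x \<in> topspace X. real N < f x}"
    have "openin X ?W" using f by (intro openin_Collect_less) auto
    moreover have "x \<in> ?W" using \<open>real (Suc N) \<le> f x\<close> xX by simp
    moreover have "refinable X d ?W" by (rule refinable_subset[OF N]) auto
    ultimately show False using x(1) unfolding core_def by blast
  qed
  ultimately show ?thesis by (intro exI[of _ \<F>]) (auto simp: \<F>_def)
qed

text \<open>Points of \<open>A\<close> have refinable neighbourhoods, but their numbers
  \<open>\<delta> W\<close> need not be bounded. Where \<open>f < N\<close>, a point of
  \<open>A\<close> has at most \<open>N\<close> peaks and lies in a dominant set inside some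
  \<open>W\<close> with \<open>\<delta> W \<le> N\<close>. Dominant sets of one cardinality are
  disjoint and share \<open>N\<close> families, giving \<open>N * N\<close> in all; the superlevel
  set of \<open>f\<close> takes \<open>d\<close> more.\<close>

lemma refinable_off_core:
  assumes fC: "finite_C_space X" and A: "closedin X A" "A \<inter> core = {}"
  shows "\<exists>d. refinable X d A"
proof -
  define \<U> where "\<U> = insert (topspace X - A) {W. openin X W \<and> (\<exists>d. refinable X d W)}"
  have \<U>op: "openin X U" if "U \<in> \<U>" for U using that A(1) by (auto simp: \<U>_def)
  have "topspace X \<subseteq> \<Union>\<U>"
  proof
    fix x assume x: "x \<in> topspace X"
    show "x \<in> \<Union>\<U>"
    proof (cases "x \<in> A")
      case True
      then have "x \<notin> core" using A by blast
      then obtain W d where "openin X W" "x \<in> W" "refinable X d W"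
        using x unfolding core_def by blast
      then show ?thesis unfolding \<U>_def by blast
    qed (use x in \<open>auto simp: \<U>_def\<close>)
  qed
  with \<U>op obtain u where u: "bump_family X \<U> (\<lambda>U. U) u"
    using bump_family_set_exists by blast
  define \<delta> where "\<delta> W = (SOME d. refinable X d W)" for W
  have \<delta>: "refinable X (\<delta> W) W" if "W \<in> \<U>" "W \<noteq> topspace X - A" for W
    using that someI_ex[of "\<lambda>d. refinable X d W"] by (auto simp: \<U>_def \<delta>_def)
  \<comment> \<open>the weighted sum bounds both the number of peaks at a point and their refinement numbers\<close>
  define c where "c W = 1 + real (\<delta> W)" for W
  define f where "f = weighted_sum \<U> c u"
  have f: "continuous_map X euclideanreal f"
    unfolding f_def by (rule continuous_map_weighted_sum[OF u])
  obtain N d where Nd: "refinable X d {x \<in> topspace X. real N \<le> f x}"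
    using refinable_superlevel[OF fC f] by blast
  define \<J> where "\<J> n = {J. J \<subseteq> \<U> \<and> finite J \<and> card J = Suc n \<and> (\<exists>W\<in>J. W \<noteq> topspace X - A \<and> \<delta> W \<le> N)}" for n
  define B where "B n = (\<Union>J\<in>\<J> n. dominant_set X \<U> u J)" for n
  have "disjoint_refinements X (N * N) \<V> (\<Union>n<N. B n)"
    if \<V>: "\<forall>V\<in>\<V>. openin X V" "topspace X \<subseteq> \<Union>\<V>" for \<V>
  proof (rule disjoint_refinements_UN_lessThan)
    fix n
    show "disjoint_refinements X N \<V> (B n)"
      unfolding B_def
    proof (rule disjoint_refinements_disjoint_UN[where G="dominant_set X \<U> u"])
      fix J assume J: "J \<in> \<J> n"
      then have J': "J \<subseteq> \<U>" "finite J" "card J = Suc n" by (auto simp: \<J>_def)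
      show "openin X (dominant_set X \<U> u J)" using openin_dominant_set[OF u J'(1,2)] .
      show "dominant_set X \<U> u J \<subseteq> dominant_set X \<U> u J" by simp
      show "disjnt (dominant_set X \<U> u J) (dominant_set X \<U> u K)" if "K \<in> \<J> n" "J \<noteq> K" for K
        by (rule disjnt_dominant_set) (use J' that in \<open>auto simp: \<J>_def\<close>)
      obtain W where W: "W \<in> J" "W \<noteq> topspace X - A" "\<delta> W \<le> N"
        using J by (auto simp: \<J>_def)
      have "refinable X N (dominant_set X \<U> u J)"
        using refinable_subset[OF refinable_mono[OF \<delta> W(3)] dominant_set_subset[OF u J'(1) W(1)]]
          W J' by blast
      then show "disjoint_refinements X N \<V> (dominant_set X \<U> u J)"
        using \<V> by (rule refinableD)
    qed
  qed
  then have "refinable X (N * N) (\<Union>n<N. B n)" by (rule refinableI)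
  then have "refinable X (N * N + d) ((\<Union>n<N. B n) \<union> {x \<in> topspace X. real N \<le> f x})"
    using Nd by (rule refinable_Un)
  moreover have "A \<subseteq> (\<Union>n<N. B n) \<union> {x \<in> topspace X. real N \<le> f x}"
  proof
    fix x assume xA: "x \<in> A"
    then have x: "x \<in> topspace X" using A(1) closedin_subset by blast
    show "x \<in> (\<Union>n<N. B n) \<union> {x \<in> topspace X. real N \<le> f x}"
    proof (cases "real N \<le> f x")
      case False
      define J where "J = {W\<in>\<U>. u W x = 1}"
      note J = peak_set[OF u x, folded J_def]
      have JU: "J \<subseteq> \<U>" by (auto simp: J_def)
      have c0: "0 \<le> c W" for W by (simp add: c_def)
      have le: "sum c J \<le> f x"
        unfolding f_def by (rule weighted_sum_ge_sum[OF u x]) (use c0 in \<open>auto simp: J_def\<close>)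
      have "real (card J) \<le> sum c J"
        using sum_mono[of J "\<lambda>_. 1" c] by (simp add: c_def)
      then have cardJ: "card J \<le> N" using le False by linarith
      obtain W where W: "W \<in> J" using J(1,2) by (metis card_gt_0_iff all_not_in_conv)
      then have "c W \<le> sum c J" using J(1) c0 by (intro member_le_sum) auto
      then have "\<delta> W \<le> N" using le False by (simp add: c_def)
      moreover have "x \<in> W" using bump_familyD(4)[OF u _ x, of W] W by (auto simp: J_def)
      then have "W \<noteq> topspace X - A" using xA by blast
      moreover obtain k where k: "card J = Suc k" using J(2) by (metis gr0_implies_Suc)
      ultimately have "J \<in> \<J> k" using J JU W unfolding \<J>_def by blast
      then have "x \<in> B k" using J(3) unfolding B_def by blast
      then show ?thesis using k cardJ by (intro UnI1 UN_I[of k]) auto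
    qed (use x in auto)
  qed
  ultimately show ?thesis using refinable_subset by blast
qed

lemma closedin_core: "closedin X core"
proof -
  have "topspace X - core = \<Union>{W. openin X W \<and> (\<exists>d. refinable X d W)}"
    unfolding core_def by (auto dest: openin_subset)
  then have "openin X (topspace X - core)" by auto
  then show ?thesis by (auto simp: closedin_def core_def)
qed

text \<open>The covers 0 to \<open>k\<close> are spent on finite subfamilies over
  \<open>core\<close>, completed by the complement of \<open>core\<close>. What their refinements
  leave is a closed set off \<open>core\<close>, refinable with a number \<open>d\<close> that holds
  for all covers; so the next \<open>d\<close> covers can take care of it.\<close>

lemma finite_C_space_arbitrary_covers:
  assumes fC: "finite_C_space X"
    and \<U>: "\<And>n::nat. \<forall>U\<in>\<U> n. openin X U" "\<And>n. topspace X \<subseteq> \<Union>(\<U> n)"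
  shows "\<exists>k \<V>. (\<forall>n<k. (\<forall>V\<in>\<V> n. openin X V \<and> (\<exists>U\<in>\<U> n. V \<subseteq> U)) \<and> pairwise disjnt (\<V> n)) \<and>
     topspace X \<subseteq> (\<Union>n<k. \<Union>(\<V> n))"
proof -
  have "\<exists>\<F>. finite \<F> \<and> \<F> \<subseteq> \<U> n \<and> core \<subseteq> \<Union>\<F>" for n
    using finite_subcover_core[OF fC, of "\<U> n"] \<U>[of n] by simp
  then obtain \<F> where \<F>: "\<And>n. finite (\<F> n)" "\<And>n. \<F> n \<subseteq> \<U> n" "\<And>n. core \<subseteq> \<Union>(\<F> n)"
    by metis
  let ?G = "\<lambda>n. insert (topspace X - core) (\<F> n)"
  have foc: "finite_open_cover X (?G n)" for n
  proof -
    have "openin X U" if "U \<in> \<F> n" for U using that \<F>(2) \<U>(1) by blast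
    moreover have "\<Union>(?G n) = topspace X"
    proof
      show "\<Union>(?G n) \<subseteq> topspace X" using calculation openin_subset by fastforce
      show "topspace X \<subseteq> \<Union>(?G n)" using \<F>(3)[of n] by blast
    qed
    ultimately show ?thesis using \<F>(1) closedin_core unfolding finite_open_cover_def by auto
  qed
  obtain k \<V> where \<V>0: "\<forall>n\<le>k. (\<forall>V\<in>\<V> n. openin X V \<and> (\<exists>U\<in>?G n. V \<subseteq> U)) \<and> pairwise disjnt (\<V> n)"
     and cov: "(\<Union>n\<le>k. \<Union>(\<V> n)) = topspace X"
    using finite_C_spaceD[where \<U>="?G", OF fC foc] by (elim exE conjE)
  have \<V>: "(\<forall>V\<in>\<V> n. openin X V \<and> (\<exists>U\<in>?G n. V \<subseteq> U)) \<and> pairwise disjnt (\<V> n)" if "n \<le> k" for n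
    using \<V>0 that by simp
  \<comment> \<open>Members that fit only into the complement of \<open>core\<close> are dropped;
    the points of \<open>core\<close> remain covered.\<close>
  define \<V>' where "\<V>' n = {V\<in>\<V> n. \<exists>U\<in>\<F> n. V \<subseteq> U}" for n
  define A where "A = topspace X - (\<Union>n\<le>k. \<Union>(\<V>' n))"
  have op: "openin X V" if "n \<le> k" "V \<in> \<V>' n" for n V
    using \<V>[OF that(1)] that(2) by (auto simp: \<V>'_def)
  then have "closedin X A" unfolding A_def by (intro closedin_diff closedin_topspace openin_Union) auto
  moreover have "A \<inter> core = {}"
  proof (rule ccontr)
    assume "A \<inter> core \<noteq> {}"
    then obtain x where x: "x \<in> A" "x \<in> core" by blast
    then have "x \<in> topspace X" by (simp add: A_def)
    then obtain n V where n: "n \<le> k" "V \<in> \<V> n" "x \<in> V" using cov by blast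
    then obtain U where U: "U \<in> ?G n" "V \<subseteq> U" using \<V>[OF n(1)] by blast
    then have "U \<in> \<F> n" using n x by blast
    then have "V \<in> \<V>' n" using U n by (auto simp: \<V>'_def)
    then show False using x n by (auto simp: A_def)
  qed
  ultimately obtain d where d: "refinable X d A" using refinable_off_core[OF fC] by blast
  \<comment> \<open>The \<open>d\<close> families all refine one cover, so a common refinement of
    the covers \<open>Suc k\<close> to \<open>k + d\<close> is taken; the \<open>i\<close>-th family
    is then used for cover \<open>Suc k + i\<close>.\<close>
  define \<C> where "\<C> = {V. openin X V \<and> (\<forall>i<d. \<exists>U\<in>\<U> (Suc k + i). V \<subseteq> U)}"
  have "topspace X \<subseteq> \<Union>\<C>"
  proof
    fix x assume x: "x \<in> topspace X"
    have "\<forall>i. \<exists>U. U \<in> \<U> (Suc k + i) \<and> x \<in> U" using \<U>(2) x by blast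
    then obtain h where h: "\<And>i. h i \<in> \<U> (Suc k + i) \<and> x \<in> h i" by metis
    let ?V = "{y \<in> topspace X. \<forall>i\<in>{..<d}. y \<in> h i}"
    have "openin X ?V"
    proof (rule openin_Collect_finite_ball)
      fix i
      have "openin X (h i)" using h \<U>(1) by blast
      moreover have "{x \<in> topspace X. x \<in> h i} = h i" using openin_subset[OF calculation] by blast
      ultimately show "openin X {x \<in> topspace X. x \<in> h i}" by simp
    qed simp
    then have "?V \<in> \<C>" using h unfolding \<C>_def by blast
    moreover have "x \<in> ?V" using h x by simp
    ultimately show "x \<in> \<Union>\<C>" by blast
  qed
  then have "disjoint_refinements X d \<C> A"
    using d by (intro refinableD) (auto simp: \<C>_def)
  then obtain \<W> where W: "\<And>i. i < d \<Longrightarrow> pairwise disjnt (\<W> i)" "\<And>i V. i < d \<Longrightarrow> V \<in> \<W> i \<Longrightarrow> openin X V"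
    "\<And>i V. i < d \<Longrightarrow> V \<in> \<W> i \<Longrightarrow> \<exists>U\<in>\<C>. V \<subseteq> U" "A \<subseteq> (\<Union>i<d. \<Union>(\<W> i))"
    by (rule disjoint_refinementsE) (rule that)
  define \<Z> where "\<Z> n = (if n \<le> k then \<V>' n else \<W> (n - Suc k))" for n
  have "(\<forall>V\<in>\<Z> n. openin X V \<and> (\<exists>U\<in>\<U> n. V \<subseteq> U)) \<and> pairwise disjnt (\<Z> n)" if n: "n < Suc k + d" for n
  proof (cases "n \<le> k")
    case True
    have "pairwise disjnt (\<V>' n)" using \<V>[OF True] unfolding \<V>'_def by (auto intro: pairwise_subset)
    moreover have "\<exists>U\<in>\<U> n. V \<subseteq> U" if "V \<in> \<V>' n" for V
      using that \<F>(2)[of n] unfolding \<V>'_def by blast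
    ultimately show ?thesis using True op[OF True] by (simp add: \<Z>_def)
  next
    case False
    define i where "i = n - Suc k"
    have i: "i < d" "n = Suc k + i" using False n by (auto simp: i_def)
    have "\<exists>U\<in>\<U> n. V \<subseteq> U" if V: "V \<in> \<W> i" for V
    proof -
      obtain C where "C \<in> \<C>" "V \<subseteq> C" using W(3)[OF i(1) V] by blast
      then obtain U where "U \<in> \<U> (Suc k + i)" "C \<subseteq> U" using i(1) by (auto simp: \<C>_def)
      then show ?thesis using i(2) \<open>V \<subseteq> C\<close> by auto
    qed
    then show ?thesis using W(1,2)[OF i(1)] False by (auto simp: \<Z>_def i_def)
  qed
  moreover have "topspace X \<subseteq> (\<Union>n<Suc k + d. \<Union>(\<Z> n))"
  proof
    fix x assume x: "x \<in> topspace X"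
    show "x \<in> (\<Union>n<Suc k + d. \<Union>(\<Z> n))"
    proof (cases "x \<in> A")
      case True
      then obtain i where "i < d" "x \<in> \<Union>(\<W> i)" using W(4) by blast
      then show ?thesis by (intro UN_I[of "Suc k + i"]) (auto simp: \<Z>_def)
    next
      case False
      then obtain n where "n \<le> k" "x \<in> \<Union>(\<V>' n)" using x by (auto simp: A_def)
      then show ?thesis by (intro UN_I[of n]) (auto simp: \<Z>_def)
    qed
  qed
  ultimately show ?thesis by (intro exI[of _ "Suc k + d"] exI[of _ \<Z>]) blast
qed

end

section \<open>The Whitehead topology and cones\<close>

abbreviation simplex_topology :: "'v set \<Rightarrow> ('v \<Rightarrow> real) topology" where
  "simplex_topology \<sigma> \<equiv> subtopology (powertop_real UNIV) (geom_simplex \<sigma>)"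

text \<open>\<open>whitehead_topology\<close> is built with \<open>topology\<close>, so its open
  sets are known only once the axioms have been checked.\<close>

lemma openin_whitehead_topology:
  "openin (whitehead_topology \<Sigma>) U \<longleftrightarrow> U \<subseteq> realization \<Sigma> \<and>
      (\<forall>\<sigma>\<in>\<Sigma>. openin (simplex_topology \<sigma>) (U \<inter> geom_simplex \<sigma>))"
proof -
  have "istopology (\<lambda>U. U \<subseteq> realization \<Sigma> \<and>
      (\<forall>\<sigma>\<in>\<Sigma>. openin (simplex_topology \<sigma>) (U \<inter> geom_simplex \<sigma>)))"
    unfolding istopology_def
  proof (intro conjI allI impI ballI)
    fix S T assume ST: "S \<subseteq> realization \<Sigma> \<and> (\<forall>\<sigma>\<in>\<Sigma>. openin (simplex_topology \<sigma>) (S \<inter> geom_simplex \<sigma>))"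
      "T \<subseteq> realization \<Sigma> \<and> (\<forall>\<sigma>\<in>\<Sigma>. openin (simplex_topology \<sigma>) (T \<inter> geom_simplex \<sigma>))"
    show "S \<inter> T \<subseteq> realization \<Sigma>" using ST by blast
    fix \<sigma> assume "\<sigma> \<in> \<Sigma>"
    then have "openin (simplex_topology \<sigma>) ((S \<inter> geom_simplex \<sigma>) \<inter> (T \<inter> geom_simplex \<sigma>))"
      using ST by (intro openin_Int[of _ "S \<inter> geom_simplex \<sigma>"]) auto
    moreover have "(S \<inter> geom_simplex \<sigma>) \<inter> (T \<inter> geom_simplex \<sigma>) = S \<inter> T \<inter> geom_simplex \<sigma>" by blast
    ultimately show "openin (simplex_topology \<sigma>) (S \<inter> T \<inter> geom_simplex \<sigma>)" by simp
  next
    fix \<K> assume K: "\<forall>K\<in>\<K>. K \<subseteq> realization \<Sigma> \<and> (\<forall>\<sigma>\<in>\<Sigma>. openin (simplex_topology \<sigma>) (K \<inter> geom_simplex \<sigma>))"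
    show "\<Union>\<K> \<subseteq> realization \<Sigma>" using K by blast
    fix \<sigma> assume "\<sigma> \<in> \<Sigma>"
    then have "openin (simplex_topology \<sigma>) (\<Union>K\<in>\<K>. K \<inter> geom_simplex \<sigma>)"
      using K by (intro openin_Union) auto
    moreover have "(\<Union>K\<in>\<K>. K \<inter> geom_simplex \<sigma>) = \<Union>\<K> \<inter> geom_simplex \<sigma>" by blast
    ultimately show "openin (simplex_topology \<sigma>) (\<Union>\<K> \<inter> geom_simplex \<sigma>)" by simp
  qed
  then show ?thesis unfolding whitehead_topology_def by (simp add: topology_inverse')
qed

lemma topspace_whitehead_topology: "topspace (whitehead_topology \<Sigma>) = realization \<Sigma>"
proof
  show "topspace (whitehead_topology \<Sigma>) \<subseteq> realization \<Sigma>"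
    using openin_topspace[of "whitehead_topology \<Sigma>"] unfolding openin_whitehead_topology by blast
  have "openin (simplex_topology \<sigma>) (realization \<Sigma> \<inter> geom_simplex \<sigma>)" if "\<sigma> \<in> \<Sigma>" for \<sigma>
  proof -
    have "realization \<Sigma> \<inter> geom_simplex \<sigma> = geom_simplex \<sigma>"
      using that by (auto simp: realization_def)
    then show ?thesis using openin_topspace[of "simplex_topology \<sigma>"] by simp
  qed
  then have "openin (whitehead_topology \<Sigma>) (realization \<Sigma>)"
    unfolding openin_whitehead_topology by simp
  then show "realization \<Sigma> \<subseteq> topspace (whitehead_topology \<Sigma>)" by (rule openin_subset)
qed

lemma continuous_map_whitehead_topology:
  assumes g: "\<And>\<sigma>. \<sigma> \<in> \<Sigma> \<Longrightarrow> continuous_map (simplex_topology \<sigma>) Y g"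
  shows "continuous_map (whitehead_topology \<Sigma>) Y g"
  unfolding continuous_map_def
proof (intro conjI allI impI)
  show "g \<in> topspace (whitehead_topology \<Sigma>) \<rightarrow> topspace Y"
  proof
    fix \<alpha> assume "\<alpha> \<in> topspace (whitehead_topology \<Sigma>)"
    then obtain \<sigma> where "\<sigma> \<in> \<Sigma>" "\<alpha> \<in> geom_simplex \<sigma>"
      unfolding topspace_whitehead_topology realization_def by blast
    then show "g \<alpha> \<in> topspace Y"
      using continuous_map_image_subset_topspace[OF g] by fastforce
  qed
  fix U assume U: "openin Y U"
  show "openin (whitehead_topology \<Sigma>) {\<alpha> \<in> topspace (whitehead_topology \<Sigma>). g \<alpha> \<in> U}"
    unfolding openin_whitehead_topology topspace_whitehead_topology
  proof (intro conjI ballI)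
    fix \<sigma> assume s: "\<sigma> \<in> \<Sigma>"
    have "openin (simplex_topology \<sigma>) {\<alpha> \<in> topspace (simplex_topology \<sigma>). g \<alpha> \<in> U}"
      by (rule openin_continuous_map_preimage[OF g[OF s] U])
    moreover have "{\<alpha> \<in> topspace (simplex_topology \<sigma>). g \<alpha> \<in> U} =
        {\<alpha> \<in> realization \<Sigma>. g \<alpha> \<in> U} \<inter> geom_simplex \<sigma>"
      using s by (auto simp: realization_def)
    ultimately show "openin (simplex_topology \<sigma>) ({\<alpha> \<in> realization \<Sigma>. g \<alpha> \<in> U} \<inter> geom_simplex \<sigma>)"
      by simp
  qed auto
qed

lemma continuous_map_simplex_whitehead:
  assumes s: "\<sigma> \<in> \<Sigma>"
  shows "continuous_map (simplex_topology \<sigma>) (whitehead_topology \<Sigma>) (\<lambda>\<alpha>. \<alpha>)"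
  unfolding continuous_map_def
proof (intro conjI allI impI)
  show "(\<lambda>\<alpha>. \<alpha>) \<in> topspace (simplex_topology \<sigma>) \<rightarrow> topspace (whitehead_topology \<Sigma>)"
    using s by (auto simp: topspace_whitehead_topology realization_def)
  fix U assume "openin (whitehead_topology \<Sigma>) U"
  then have "openin (simplex_topology \<sigma>) (U \<inter> geom_simplex \<sigma>)"
    using s unfolding openin_whitehead_topology by blast
  moreover have "{\<alpha> \<in> topspace (simplex_topology \<sigma>). \<alpha> \<in> U} = U \<inter> geom_simplex \<sigma>" by auto
  ultimately show "openin (simplex_topology \<sigma>) {\<alpha> \<in> topspace (simplex_topology \<sigma>). \<alpha> \<in> U}" by simp
qed

section \<open>Extension of maps over cones\<close>

lemma hook_omega_contraction:
  fixes \<Sigma> :: "'v set set"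
  assumes hook: "hook_omega TYPE('v) m S T" and T: "T \<noteq> {}"
    and \<Sigma>: "simplicial_complex \<Sigma>" "finite_dimensional \<Sigma>"
    and g: "continuous_map (whitehead_topology \<Sigma>) (subtopology (mtopology_of m) S) g"
  shows "\<exists>c H. c \<in> T \<and>
     continuous_map (prod_topology (top_of_set {0..1}) (whitehead_topology \<Sigma>)) (subtopology (mtopology_of m) T) H \<and>
     (\<forall>z. H (0::real, z) = g z) \<and> (\<forall>z\<in>realization \<Sigma>. H (1, z) = c)"
proof -
  obtain c where "homotopic_with (\<lambda>h. True) (whitehead_topology \<Sigma>)
               (subtopology (mtopology_of m) T) g (\<lambda>_. c)"
    using hook \<Sigma> g unfolding hook_omega_def by blast
  then obtain H where H: "continuous_map (prod_topology (top_of_set {0..1::real}) (whitehead_topology \<Sigma>))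
       (subtopology (mtopology_of m) T) H" "\<And>z. H (0, z) = g z" "\<And>z. H (1, z) = c"
    unfolding homotopic_with_def by blast
  \<comment> \<open>over an empty complex the constant \<open>c\<close> need not lie in \<open>T\<close>\<close>
  show ?thesis
  proof (cases "realization \<Sigma> = {}")
    case True
    then show ?thesis using H T by blast
  next
    case False
    then obtain z where "z \<in> realization \<Sigma>" by blast
    then have "(1, z) \<in> topspace (prod_topology (top_of_set {0..1::real}) (whitehead_topology \<Sigma>))"
      by (simp add: topspace_whitehead_topology)
    then have "H (1, z) \<in> T"
      using continuous_map_image_subset_topspace[OF H(1)] by fastforce
    then show ?thesis using H by auto
  qed
qed

text \<open>The map is constant on the upper half of the cone, so that normalising the coordinates of the
  base by \<open>1 - \<alpha> v\<close> causes no trouble at the apex \<open>v\<close>.\<close>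
definition cone_map :: "'v \<Rightarrow> 'b \<Rightarrow> (real \<times> ('v \<Rightarrow> real) \<Rightarrow> 'b) \<Rightarrow> ('v \<Rightarrow> real) \<Rightarrow> 'b" where
  "cone_map v c H \<alpha> =
     (if 1/2 \<le> \<alpha> v then c else H (2 * \<alpha> v, \<lambda>w. if w = v then 0 else \<alpha> w / (1 - \<alpha> v)))"

lemma geom_simplex_face_scaled:
  assumes "finite \<tau>" "v \<notin> \<tau>" "\<alpha> \<in> geom_simplex (insert v \<tau>)" "\<alpha> v < 1"
  shows "(\<lambda>w. if w = v then 0 else \<alpha> w / (1 - \<alpha> v)) \<in> geom_simplex \<tau>"
proof -
  have "sum \<alpha> \<tau> = 1 - \<alpha> v" using assms by (simp add: geom_simplex_def)
  moreover have "(\<Sum>w\<in>\<tau>. if w = v then 0 else \<alpha> w / (1 - \<alpha> v)) = (\<Sum>w\<in>\<tau>. \<alpha> w / (1 - \<alpha> v))"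
    using assms(2) by (intro sum.cong) auto
  ultimately have "(\<Sum>w\<in>\<tau>. if w = v then 0 else \<alpha> w / (1 - \<alpha> v)) = 1"
    using assms(4) by (simp flip: sum_divide_distrib)
  then show ?thesis using assms by (auto simp: geom_simplex_def)
qed

text \<open>Continuity is needed only on closed simplices. Where \<open>\<alpha> v \<le> 1/2\<close>
  the rescaled point lies in the face \<open>\<tau>\<close>, with denominator at least 1/2; at
  \<open>\<alpha> v = 1/2\<close> the homotopy has reached its end \<open>c\<close>, so the two
  formulas fit. For empty \<open>\<tau>\<close> only the apex is left.\<close>

lemma cone_map_continuous:
  assumes \<tau>: "finite \<tau>" "v \<notin> \<tau>" "\<tau> = {} \<or> \<tau> \<in> \<Sigma>" and c: "c \<in> topspace Y"
    and H: "continuous_map (prod_topology (top_of_set {0..1}) (whitehead_topology \<Sigma>)) Y H"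
    and H1: "\<And>z. z \<in> realization \<Sigma> \<Longrightarrow> H (1, z) = c"
  shows "continuous_map (simplex_topology (insert v \<tau>)) Y (cone_map v c H)"
proof (cases "\<tau> = {}")
  case True
  have "continuous_map (simplex_topology (insert v \<tau>)) Y (\<lambda>_. c)" using c by simp
  then show ?thesis
    by (rule continuous_map_eq) (use True in \<open>auto simp: cone_map_def geom_simplex_def\<close>)
next
  case False
  then have \<tau>\<Sigma>: "\<tau> \<in> \<Sigma>" using \<tau> by blast
  let ?\<sigma> = "insert v \<tau>"
  let ?r = "\<lambda>\<alpha> w. if w = v then 0 else \<alpha> w / (1 - \<alpha> v) :: real"
  let ?Z = "{\<alpha>. \<alpha> \<in> topspace (simplex_topology ?\<sigma>) \<and> \<alpha> v \<le> 1/2}"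
  let ?S = "subtopology (simplex_topology ?\<sigma>) ?Z"
  have proj: "continuous_map (simplex_topology ?\<sigma>) euclideanreal (\<lambda>\<alpha>. \<alpha> w)" for w
    by (intro continuous_map_from_subtopology continuous_map_product_projection) simp
  have projS: "continuous_map ?S euclideanreal (\<lambda>\<alpha>. \<alpha> w)" for w
    by (intro continuous_map_from_subtopology proj)
  have topS: "\<alpha> \<in> geom_simplex ?\<sigma>" "\<alpha> v \<le> 1/2" "0 \<le> \<alpha> v" if "\<alpha> \<in> topspace ?S" for \<alpha>
    using that by (auto simp: geom_simplex_def)
  have rz: "?r \<alpha> \<in> geom_simplex \<tau>" if "\<alpha> \<in> topspace ?S" for \<alpha>
    using geom_simplex_face_scaled[OF \<tau>(1,2) topS(1)[OF that]] topS(2)[OF that] by simp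
  have "continuous_map ?S (powertop_real UNIV) ?r"
    unfolding continuous_map_componentwise_UNIV
  proof
    fix w
    show "continuous_map ?S euclideanreal (\<lambda>\<alpha>. ?r \<alpha> w)"
    proof (cases "w = v")
      case False
      have "continuous_map ?S euclideanreal (\<lambda>\<alpha>. \<alpha> w / (1 - \<alpha> v))"
      proof (rule continuous_map_real_divide[OF projS])
        show "continuous_map ?S euclideanreal (\<lambda>\<alpha>. 1 - \<alpha> v)"
          using projS by (intro continuous_map_diff) auto
        show "1 - \<alpha> v \<noteq> 0" if "\<alpha> \<in> topspace ?S" for \<alpha> using topS(2)[OF that] by simp
      qed
      then show ?thesis using False by simp
    qed simp
  qed
  then have "continuous_map ?S (simplex_topology \<tau>) ?r"
    unfolding continuous_map_in_subtopology using rz by blast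
  then have "continuous_map ?S (whitehead_topology \<Sigma>) ((\<lambda>\<alpha>. \<alpha>) \<circ> ?r)"
    using continuous_map_simplex_whitehead[OF \<tau>\<Sigma>] by (rule continuous_map_compose)
  then have cr: "continuous_map ?S (whitehead_topology \<Sigma>) ?r" by (simp add: o_def)
  have "continuous_map ?S euclideanreal (\<lambda>\<alpha>. 2 * \<alpha> v)"
    using projS by (intro continuous_map_real_mult_left)
  moreover have "(\<lambda>\<alpha>. 2 * \<alpha> v) ` topspace ?S \<subseteq> {0..1}"
    using topS by force
  ultimately have "continuous_map ?S (top_of_set {0..1}) (\<lambda>\<alpha>. 2 * \<alpha> v)"
    unfolding continuous_map_in_subtopology by blast
  then have "continuous_map ?S (prod_topology (top_of_set {0..1}) (whitehead_topology \<Sigma>)) (\<lambda>\<alpha>. (2 * \<alpha> v, ?r \<alpha>))"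
    using cr by (rule continuous_map_pairedI)
  then have "continuous_map ?S Y (H \<circ> (\<lambda>\<alpha>. (2 * \<alpha> v, ?r \<alpha>)))"
    using H by (rule continuous_map_compose)
  then have contH: "continuous_map ?S Y (\<lambda>\<alpha>. H (2 * \<alpha> v, ?r \<alpha>))" by (simp add: o_def)
  have "continuous_map (simplex_topology ?\<sigma>) Y
      (\<lambda>\<alpha>. if 1/2 \<le> \<alpha> v then c else H (2 * \<alpha> v, ?r \<alpha>))"
  proof (rule continuous_map_cases_le[OF _ proj _ contH])
    fix \<alpha> assume a: "\<alpha> \<in> topspace (simplex_topology ?\<sigma>)" "1/2 = \<alpha> v"
    then have "?r \<alpha> \<in> geom_simplex \<tau>" by (intro rz) auto
    then have "?r \<alpha> \<in> realization \<Sigma>" using \<tau>\<Sigma> by (auto simp: realization_def)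
    then show "c = H (2 * \<alpha> v, ?r \<alpha>)" using H1 a by (metis (no_types, lifting) field_sum_of_halves mult_2)
  qed (use c in auto)
  then show ?thesis unfolding cone_map_def .
qed

lemma cone_map_in:
  assumes \<tau>: "finite \<tau>" "v \<notin> \<tau>" "\<tau> = {} \<or> \<tau> \<in> \<Sigma>" and c: "c \<in> T"
    and H: "continuous_map (prod_topology (top_of_set {0..1}) (whitehead_topology \<Sigma>)) (subtopology Y T) H"
    and H1: "\<And>z. z \<in> realization \<Sigma> \<Longrightarrow> H (1, z) = c"
    and cY: "c \<in> topspace Y"
    and a: "\<alpha> \<in> geom_simplex (insert v \<tau>)"
  shows "cone_map v c H \<alpha> \<in> T"
proof -
  have "c \<in> topspace (subtopology Y T)" using c cY by simp
  from continuous_map_image_subset_topspace[OF cone_map_continuous[OF \<tau> this H H1]] a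
  show ?thesis by auto
qed

definition nerve :: "'v set \<Rightarrow> ('v \<Rightarrow> 'a set) \<Rightarrow> 'v set set" where
  "nerve S C = {\<sigma>. finite \<sigma> \<and> \<sigma> \<noteq> {} \<and> \<sigma> \<subseteq> S \<and> (\<Inter>v\<in>\<sigma>. C v) \<noteq> {}}"

text \<open>Values are controlled at every point \<open>p\<close> common to the sets of the simplex,
  not at a chosen one: this is what the canonical map into the nerve needs, and what sends the link
  of a vertex into a single set \<open>A\<close>.\<close>

definition carried_map ::
    "'b metric \<Rightarrow> ('v \<Rightarrow> 'a set) \<Rightarrow> ('a \<Rightarrow> 'b set) \<Rightarrow> 'v set set \<Rightarrow> (('v \<Rightarrow> real) \<Rightarrow> 'b) \<Rightarrow> bool" where
  "carried_map m C R \<Sigma> g \<longleftrightarrow>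
     (\<forall>\<sigma>\<in>\<Sigma>. continuous_map (simplex_topology \<sigma>) (mtopology_of m) g \<and>
        (\<forall>\<alpha>\<in>geom_simplex \<sigma>. \<forall>p\<in>(\<Inter>v\<in>\<sigma>. C v). g \<alpha> \<in> R p))"

section \<open>Maps on nerves\<close>

lemma simplicial_complex_nerve: "simplicial_complex (nerve S C)"
  unfolding simplicial_complex_def
proof (intro ballI conjI allI impI)
  fix \<sigma> assume s: "\<sigma> \<in> nerve S C"
  then show "finite \<sigma>" "\<sigma> \<noteq> {}" by (auto simp: nerve_def)
  fix \<tau> assume t: "\<tau> \<subseteq> \<sigma> \<and> \<tau> \<noteq> {}"
  have "(\<Inter>v\<in>\<sigma>. C v) \<subseteq> (\<Inter>v\<in>\<tau>. C v)" using t by blast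
  then show "\<tau> \<in> nerve S C" using s t by (auto simp: nerve_def intro: finite_subset)
qed

text \<open>The sets of a level being disjoint, a simplex has at most one vertex \<open>v\<close> of
  level \<open>n\<close>; the rest of it lies in the link \<open>L v\<close> among the higher
  levels. A point common to the simplex lies in \<open>C v\<close>, so \<open>g\<close> maps the
  link into \<open>A\<close>, and a contraction inside \<open>B\<close> extends \<open>g\<close>
  over the cone. Simplices without such a vertex keep \<open>g\<close>, as \<open>R'\<close> is
  contained in \<open>R\<close>.\<close>

lemma carried_map_cone_step:
  fixes S :: "'v set" and C :: "'v \<Rightarrow> 'a set" and R R' :: "'a \<Rightarrow> 'b set"
  assumes disj: "\<And>v w. v \<in> S \<Longrightarrow> w \<in> S \<Longrightarrow> lev v = lev w \<Longrightarrow> v \<noteq> w \<Longrightarrow> disjnt (C v) (C w)"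
    and bnd: "\<And>v. v \<in> S \<Longrightarrow> lev v < (k::nat)"
    and AB: "\<And>v. v \<in> S \<Longrightarrow> lev v = n \<Longrightarrow> \<exists>A B. hook_omega TYPE('v) m A B \<and> B \<noteq> {} \<and> B \<subseteq> mspace m \<and>
        (\<forall>p\<in>C v. R' p \<subseteq> A \<and> B \<subseteq> R p)"
    and mono: "\<And>v p. v \<in> S \<Longrightarrow> p \<in> C v \<Longrightarrow> R' p \<subseteq> R p"
    and g: "carried_map m C R' (nerve {v\<in>S. Suc n \<le> lev v} C) g"
  shows "\<exists>g. carried_map m C R (nerve {v\<in>S. n \<le> lev v} C) g"
proof -
  let ?K = "nerve {v\<in>S. Suc n \<le> lev v} C"
  define L where "L v = {\<tau> \<in> ?K. insert v \<tau> \<in> nerve S C}" for v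
  have gc: "continuous_map (simplex_topology \<sigma>) (mtopology_of m) g" if "\<sigma> \<in> ?K" for \<sigma>
    using g that unfolding carried_map_def by blast
  have gR: "g \<alpha> \<in> R' p" if "\<sigma> \<in> ?K" "\<alpha> \<in> geom_simplex \<sigma>" "p \<in> (\<Inter>v\<in>\<sigma>. C v)" for \<sigma> \<alpha> p
    using g that unfolding carried_map_def by blast
  have "\<exists>B c H. B \<subseteq> mspace m \<and> (\<forall>p\<in>C v. B \<subseteq> R p) \<and> c \<in> B \<and>
     continuous_map (prod_topology (top_of_set {0..1::real}) (whitehead_topology (L v))) (subtopology (mtopology_of m) B) H \<and>
     (\<forall>z. H (0, z) = g z) \<and> (\<forall>z\<in>realization (L v). H (1, z) = c)"
    if v: "v \<in> S" "lev v = n" for v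
  proof -
    obtain A B where AB: "hook_omega TYPE('v) m A B" "B \<noteq> {}" "B \<subseteq> mspace m"
        "\<forall>p\<in>C v. R' p \<subseteq> A \<and> B \<subseteq> R p"
      using AB[OF v] by blast
    have "simplicial_complex (L v)"
      unfolding simplicial_complex_def
    proof (intro ballI conjI allI impI)
      fix \<tau> assume t: "\<tau> \<in> L v"
      then show "finite \<tau>" "\<tau> \<noteq> {}" by (auto simp: L_def nerve_def)
      fix \<rho> assume r: "\<rho> \<subseteq> \<tau> \<and> \<rho> \<noteq> {}"
      have "\<rho> \<in> ?K"
        using simplicial_complex_nerve[of "{v\<in>S. Suc n \<le> lev v}" C] t r
        unfolding simplicial_complex_def L_def by blast
      moreover have "insert v \<rho> \<subseteq> insert v \<tau>" "insert v \<rho> \<noteq> {}" using r by auto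
      then have "insert v \<rho> \<in> nerve S C"
        using simplicial_complex_nerve[of S C] t unfolding simplicial_complex_def L_def by blast
      ultimately show "\<rho> \<in> L v" by (simp add: L_def)
    qed
    moreover have "finite_dimensional (L v)"
      unfolding finite_dimensional_def
    proof (intro exI[of _ k] ballI)
      fix \<tau> assume "\<tau> \<in> L v"
      then have t: "finite \<tau>" "\<tau> \<subseteq> S" "(\<Inter>v\<in>\<tau>. C v) \<noteq> {}" by (auto simp: L_def nerve_def)
      \<comment> \<open>Vertices of one simplex have distinct levels below \<open>k\<close>; this
        makes the link finite-dimensional, as the UV property demands.\<close>
      have "inj_on lev \<tau>"
      proof (rule inj_onI, rule ccontr)
        fix w w' assume w: "w \<in> \<tau>" "w' \<in> \<tau>" "lev w = lev w'" "w \<noteq> w'"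
        then have "disjnt (C w) (C w')" using disj t(2) by blast
        moreover obtain p where "p \<in> (\<Inter>v\<in>\<tau>. C v)" using t(3) by blast
        ultimately show False using w by (auto simp: disjnt_iff)
      qed
      moreover have "lev ` \<tau> \<subseteq> {..<k}" using bnd t(2) by blast
      ultimately have "card \<tau> \<le> card {..<k}" by (intro card_inj_on_le) auto
      then show "card \<tau> \<le> k + 1" by simp
    qed
    moreover have "continuous_map (whitehead_topology (L v)) (subtopology (mtopology_of m) A) g"
    proof (rule continuous_map_whitehead_topology)
      fix \<tau> assume "\<tau> \<in> L v"
      then have t: "\<tau> \<in> ?K" "insert v \<tau> \<in> nerve S C" by (auto simp: L_def)
      then obtain p where p: "p \<in> (\<Inter>w\<in>insert v \<tau>. C w)" by (auto simp: nerve_def)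
      have "g \<alpha> \<in> A" if "\<alpha> \<in> geom_simplex \<tau>" for \<alpha>
      proof -
        have "g \<alpha> \<in> R' p" using p by (intro gR[OF t(1) that]) auto
        moreover have "R' p \<subseteq> A" using AB(4) p by blast
        ultimately show ?thesis by blast
      qed
      then show "continuous_map (simplex_topology \<tau>) (subtopology (mtopology_of m) A) g"
        using gc[OF t(1)] by (auto simp: continuous_map_in_subtopology)
    qed
    ultimately have "\<exists>c H. c \<in> B \<and>
       continuous_map (prod_topology (top_of_set {0..1}) (whitehead_topology (L v))) (subtopology (mtopology_of m) B) H \<and>
       (\<forall>z. H (0::real, z) = g z) \<and> (\<forall>z\<in>realization (L v). H (1, z) = c)"
      by (rule hook_omega_contraction[OF AB(1,2)])
    then obtain c H where cH: "c \<in> B" "continuous_map (prod_topology (top_of_set {0..1}) (whitehead_topology (L v))) (subtopology (mtopology_of m) B) H"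
       "\<forall>z. H (0::real, z) = g z" "\<forall>z\<in>realization (L v). H (1, z) = c"
      by (elim exE conjE)
    have "\<forall>p\<in>C v. B \<subseteq> R p" using AB(4) by blast
    then show ?thesis using AB(3) cH by (intro exI[of _ B] exI[of _ c] exI[of _ H] conjI)
  qed
  then have "\<forall>v. \<exists>B c H. v \<in> S \<longrightarrow> lev v = n \<longrightarrow> (B \<subseteq> mspace m \<and> (\<forall>p\<in>C v. B \<subseteq> R p) \<and> c \<in> B \<and>
     continuous_map (prod_topology (top_of_set {0..1::real}) (whitehead_topology (L v))) (subtopology (mtopology_of m) B) H \<and>
     (\<forall>z. H (0, z) = g z) \<and> (\<forall>z\<in>realization (L v). H (1, z) = c))"
    by meson
  then obtain B c H where BcH: "\<forall>v. v \<in> S \<longrightarrow> lev v = n \<longrightarrow> (B v \<subseteq> mspace m \<and> (\<forall>p\<in>C v. B v \<subseteq> R p) \<and> c v \<in> B v \<and>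
     continuous_map (prod_topology (top_of_set {0..1::real}) (whitehead_topology (L v))) (subtopology (mtopology_of m) (B v)) (H v) \<and>
     (\<forall>z. H v (0, z) = g z) \<and> (\<forall>z\<in>realization (L v). H v (1, z) = c v))"
    by (elim choice[elim_format] exE)
  have B: "B v \<subseteq> mspace m" "\<And>p. p \<in> C v \<Longrightarrow> B v \<subseteq> R p" "c v \<in> B v"
     "continuous_map (prod_topology (top_of_set {0..1::real}) (whitehead_topology (L v))) (subtopology (mtopology_of m) (B v)) (H v)"
     "\<And>z. H v (0, z) = g z" "\<And>z. z \<in> realization (L v) \<Longrightarrow> H v (1, z) = c v" if "v \<in> S" "lev v = n" for v
    using BcH that by auto
  define P where "P \<alpha> v \<longleftrightarrow> v \<in> S \<and> lev v = n \<and> 0 < \<alpha> v" for \<alpha> :: "'v \<Rightarrow> real" and v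
  \<comment> \<open>On a simplex of the nerve at most one \<open>v\<close> satisfies
    \<open>P \<alpha> v\<close>, so the choice by \<open>SOME\<close> is forced and one global
    \<open>G\<close> restricts to the right map on each simplex.\<close>
  define G where "G \<alpha> = (if \<exists>v. P \<alpha> v then let v = SOME v. P \<alpha> v in cone_map v (c v) (H v) \<alpha> else g \<alpha>)" for \<alpha>
  have "carried_map m C R (nerve {v\<in>S. n \<le> lev v} C) G"
    unfolding carried_map_def
  proof
    fix \<sigma> assume \<sigma>: "\<sigma> \<in> nerve {v\<in>S. n \<le> lev v} C"
    then have \<sigma>': "finite \<sigma>" "\<sigma> \<noteq> {}" "\<sigma> \<subseteq> S" "(\<Inter>v\<in>\<sigma>. C v) \<noteq> {}" "\<And>v. v \<in> \<sigma> \<Longrightarrow> n \<le> lev v"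
      by (auto simp: nerve_def)
    then obtain p0 where p0: "\<And>v. v \<in> \<sigma> \<Longrightarrow> p0 \<in> C v" by blast
    have zero: "\<alpha> w = 0" if "\<alpha> \<in> geom_simplex \<sigma>" "w \<notin> \<sigma>" for \<alpha> w
      using that by (auto simp: geom_simplex_def)
    show "continuous_map (simplex_topology \<sigma>) (mtopology_of m) G \<and>
        (\<forall>\<alpha>\<in>geom_simplex \<sigma>. \<forall>p\<in>(\<Inter>v\<in>\<sigma>. C v). G \<alpha> \<in> R p)"
    proof (cases "\<exists>v\<in>\<sigma>. lev v = n")
      case False
      then have \<sigma>K: "\<sigma> \<in> ?K"
        using \<sigma>' by (auto simp: nerve_def Suc_le_eq order_less_le)
      have eq: "g \<alpha> = G \<alpha>" if "\<alpha> \<in> geom_simplex \<sigma>" for \<alpha>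
      proof -
        have "\<not> P \<alpha> v" for v using zero[OF that, of v] False by (auto simp: P_def)
        then show ?thesis by (simp add: G_def)
      qed
      have "continuous_map (simplex_topology \<sigma>) (mtopology_of m) G"
        by (rule continuous_map_eq[OF gc[OF \<sigma>K]]) (use eq in auto)
      moreover have "G \<alpha> \<in> R p" if "\<alpha> \<in> geom_simplex \<sigma>" "p \<in> (\<Inter>v\<in>\<sigma>. C v)" for \<alpha> p
      proof -
        obtain v where "v \<in> \<sigma>" using \<sigma>'(2) by blast
        then have "R' p \<subseteq> R p" using mono[of v p] \<sigma>'(3) that(2) by blast
        then show ?thesis using gR[OF \<sigma>K that] eq[OF that(1)] by auto
      qed
      ultimately show ?thesis by blast
    next
      case True
      then obtain v where v: "v \<in> \<sigma>" "lev v = n" by blast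
      then have vS: "v \<in> S" using \<sigma>' by blast
      note Bv = B[OF vS v(2)]
      have uniq: "w = v" if "w \<in> \<sigma>" "lev w = n" for w
      proof (rule ccontr)
        assume "w \<noteq> v"
        then have "disjnt (C w) (C v)" using disj[of w v] that v \<sigma>'(3) by auto
        then show False using p0[of w] p0[of v] that v by (auto simp: disjnt_iff)
      qed
      define \<tau> where "\<tau> = \<sigma> - {v}"
      have \<tau>: "finite \<tau>" "v \<notin> \<tau>" "insert v \<tau> = \<sigma>" using \<sigma>' v by (auto simp: \<tau>_def)
      have \<tau>L: "\<tau> = {} \<or> \<tau> \<in> L v"
      proof (cases "\<tau> = {}")
        case False
        have "Suc n \<le> lev w" if "w \<in> \<tau>" for w
          using that uniq[of w] \<sigma>'(5)[of w] by (auto simp: \<tau>_def Suc_le_eq order_less_le)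
        moreover have "(\<Inter>w\<in>\<tau>. C w) \<noteq> {}" using p0 by (auto simp: \<tau>_def)
        ultimately have "\<tau> \<in> ?K" using False \<sigma>' by (auto simp: nerve_def \<tau>_def)
        moreover have "insert v \<tau> \<in> nerve S C" using \<sigma>' unfolding \<tau>(3) by (auto simp: nerve_def)
        ultimately show ?thesis by (simp add: L_def)
      qed simp
      \<comment> \<open>Where the weight of \<open>v\<close> vanishes, the cone map starts at
        \<open>H v (0, \<alpha>) = g \<alpha>\<close>, so it agrees with the map on the opposite
        face.\<close>
      have eq: "cone_map v (c v) (H v) \<alpha> = G \<alpha>" if a: "\<alpha> \<in> geom_simplex \<sigma>" for \<alpha>
      proof (cases "\<alpha> v = 0")
        case True
        have "\<not> P \<alpha> w" for w
          using True zero[OF a, of w] uniq[of w] by (cases "w \<in> \<sigma>") (auto simp: P_def)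
        then have "G \<alpha> = g \<alpha>" by (simp add: G_def)
        moreover have "(\<lambda>w. if w = v then 0 else \<alpha> w / (1 - \<alpha> v)) = \<alpha>" using True by auto
        ultimately show ?thesis using True Bv(5) by (simp add: cone_map_def)
      next
        case False
        then have "0 < \<alpha> v" using a by (auto simp: geom_simplex_def order_less_le)
        then have "P \<alpha> v" using vS v by (simp add: P_def)
        moreover have "w = v" if "P \<alpha> w" for w
          using that zero[OF a, of w] uniq[of w] by (auto simp: P_def)
        ultimately have "(SOME v. P \<alpha> v) = v" by (intro some_equality)
        then show ?thesis using \<open>P \<alpha> v\<close> by (auto simp: G_def)
      qed
      have cY: "c v \<in> topspace (mtopology_of m)" using Bv(1,3) by auto
      then have "c v \<in> topspace (subtopology (mtopology_of m) (B v))" using Bv(3) by simp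
      from cone_map_continuous[OF \<tau>(1,2) \<tau>L this Bv(4,6)]
      have cont: "continuous_map (simplex_topology \<sigma>) (subtopology (mtopology_of m) (B v)) (cone_map v (c v) (H v))"
        unfolding \<tau>(3) by simp
      then have "continuous_map (simplex_topology \<sigma>) (mtopology_of m) (cone_map v (c v) (H v))"
        using continuous_map_in_subtopology by blast
      then have "continuous_map (simplex_topology \<sigma>) (mtopology_of m) G"
        by (rule continuous_map_eq) (use eq in auto)
      moreover have "G \<alpha> \<in> R p" if "\<alpha> \<in> geom_simplex \<sigma>" "p \<in> (\<Inter>v\<in>\<sigma>. C v)" for \<alpha> p
      proof -
        have "cone_map v (c v) (H v) \<alpha> \<in> B v"
          by (rule cone_map_in[OF \<tau>(1,2) \<tau>L Bv(3,4,6) cY]) (use that \<tau>(3) in auto)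
        then show ?thesis using eq[OF that(1)] Bv(2)[of p] that(2) v by auto
      qed
      ultimately show ?thesis by blast
    qed
  qed
  then show ?thesis by blast
qed

text \<open>From level \<open>k\<close>, where the nerve is empty, one level is coned off at a time
  while the carrier widens from \<open>R (Suc n)\<close> to \<open>R n\<close>; the sets
  \<open>A\<close> and \<open>B\<close> of a vertex of level \<open>n\<close> relate exactly these
  two carriers.\<close>

lemma carried_map_exists:
  fixes S :: "'v set" and C :: "'v \<Rightarrow> 'a set" and R :: "nat \<Rightarrow> 'a \<Rightarrow> 'b set"
  assumes disj: "\<And>v w. v \<in> S \<Longrightarrow> w \<in> S \<Longrightarrow> lev v = lev w \<Longrightarrow> v \<noteq> w \<Longrightarrow> disjnt (C v) (C w)"
    and bnd: "\<And>v. v \<in> S \<Longrightarrow> lev v < (k::nat)"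
    and AB: "\<And>v. v \<in> S \<Longrightarrow> \<exists>A B. hook_omega TYPE('v) m A B \<and> B \<noteq> {} \<and> B \<subseteq> mspace m \<and>
        (\<forall>p\<in>C v. R (Suc (lev v)) p \<subseteq> A \<and> B \<subseteq> R (lev v) p)"
    and mono: "\<And>n v p. v \<in> S \<Longrightarrow> p \<in> C v \<Longrightarrow> R (Suc n) p \<subseteq> R n p"
  shows "\<exists>g. carried_map m C (R 0) (nerve S C) g"
proof -
  have "\<exists>g. carried_map m C (R (k - j)) (nerve {v\<in>S. k - j \<le> lev v} C) g" if "j \<le> k" for j
    using that
  proof (induction j)
    case 0
    have "nerve {v\<in>S. k \<le> lev v} C = {}" using bnd by (fastforce simp: nerve_def)
    then show ?case by (simp add: carried_map_def)
  next
    case (Suc j)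
    then have "\<exists>g. carried_map m C (R (k - j)) (nerve {v\<in>S. k - j \<le> lev v} C) g" by simp
    then obtain g where g: "carried_map m C (R (k - j)) (nerve {v\<in>S. k - j \<le> lev v} C) g" by blast
    have S: "Suc (k - Suc j) = k - j" using Suc by simp
    show ?case
    proof (rule carried_map_cone_step[OF disj bnd, where R'="R (k - j)"])
      show "carried_map m C (R (k - j)) (nerve {v\<in>S. Suc (k - Suc j) \<le> lev v} C) g"
        using g S by simp
      show "R (k - j) p \<subseteq> R (k - Suc j) p" if "v \<in> S" "p \<in> C v" for v p
        using mono[OF that, of "k - Suc j"] S by simp
      show "\<exists>A B. hook_omega TYPE('v) m A B \<and> B \<noteq> {} \<and> B \<subseteq> mspace m \<and>
        (\<forall>p\<in>C v. R (k - j) p \<subseteq> A \<and> B \<subseteq> R (k - Suc j) p)" if "v \<in> S" "lev v = k - Suc j" for v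
        using AB[OF that(1)] S that(2) by simp
    qed
  qed
  from this[of k] show ?thesis by simp
qed

section \<open>Selections\<close>

lemma Onbhd_mono: "a \<le> b \<Longrightarrow> Onbhd m a S \<subseteq> Onbhd m b S"
  unfolding Onbhd_def by force

lemma subset_Onbhd:
  assumes "S \<subseteq> mspace m" "0 < a"
  shows "S \<subseteq> Onbhd m a S"
proof
  fix x assume x: "x \<in> S"
  then have "mdist m x x < a" using assms by (metis mdist_zero subsetD)
  then show "x \<in> Onbhd m a S" using x assms by (auto simp: Onbhd_def)
qed

lemma Onbhd_Onbhd:
  assumes "S \<subseteq> Onbhd m a T" "T \<subseteq> mspace m"
  shows "Onbhd m b S \<subseteq> Onbhd m (a + b) T"
proof
  fix y assume "y \<in> Onbhd m b S"
  then obtain q where q: "y \<in> mspace m" "q \<in> S" "mdist m y q < b" by (auto simp: Onbhd_def)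
  then obtain t where t: "q \<in> mspace m" "t \<in> T" "mdist m q t < a" using assms(1) by (auto simp: Onbhd_def)
  have "mdist m y t \<le> mdist m y q + mdist m q t" using q t assms(2) by (intro mdist_triangle) auto
  then have "mdist m y t < a + b" using q t by linarith
  then show "y \<in> Onbhd m (a + b) T" using q t by (auto simp: Onbhd_def)
qed

section \<open>Scales adapted to the UV property, and passage from the nerve to the space\<close>

context paracompact_normal
begin

text \<open>\<open>A\<close> and \<open>B\<close> are the neighbourhoods of \<open>\<phi> x\<close>
  of radii \<open>d x\<close> and \<open>e x / 4\<close>. Moving from \<open>\<phi> p\<close> to
  \<open>\<phi> x\<close> costs \<open>d x / 2\<close>, which with \<open>e' p < d x / 2\<close>
  stays within \<open>d x\<close>; moving back gives
  \<open>e x / 4 + e x / 4 = e x / 2 < e p\<close>. The numbers \<open>d x\<close> are chosen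
  pointwise, so a continuous \<open>e'\<close> is obtained by averaging.\<close>

lemma scale_step:
  fixes \<phi> :: "'a \<Rightarrow> 'b set"
  assumes \<phi>: "\<And>x. x \<in> topspace X \<Longrightarrow> \<phi> x \<noteq> {} \<and> \<phi> x \<subseteq> mspace m"
    and rho: "rho_continuous X m \<phi>"
    and UV: "\<And>x. x \<in> topspace X \<Longrightarrow> uniformly_UV_omega T m (\<phi> x)"
    and e: "continuous_map X euclideanreal e" and e0: "\<And>x. x \<in> topspace X \<Longrightarrow> 0 < e x"
  shows "\<exists>\<U> e'. continuous_map X euclideanreal e' \<and> (\<forall>x\<in>topspace X. 0 < e' x \<and> e' x \<le> e x) \<and>
     (\<forall>U\<in>\<U>. openin X U) \<and> topspace X \<subseteq> \<Union>\<U> \<and>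
     (\<forall>U\<in>\<U>. \<exists>A B. hook_omega T m A B \<and> B \<noteq> {} \<and> B \<subseteq> mspace m \<and>
        (\<forall>p\<in>U. Onbhd m (e' p) (\<phi> p) \<subseteq> A \<and> B \<subseteq> Onbhd m (e p) (\<phi> p)))"
proof -
  have "\<exists>d V. 0 < d \<and> d \<le> e x / 4 \<and> hook_omega T m (Onbhd m d (\<phi> x)) (Onbhd m (e x / 4) (\<phi> x)) \<and>
     openin X V \<and> x \<in> V \<and> (\<forall>p\<in>V. \<phi> p \<subseteq> Onbhd m (d / 2) (\<phi> x) \<and> \<phi> x \<subseteq> Onbhd m (e x / 4) (\<phi> p) \<and> e x / 2 < e p)"
    if x: "x \<in> topspace X" for x
  proof -
    have r: "0 < e x / 4" using e0[OF x] by simp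
    obtain d where d: "0 < d" "d \<le> e x / 4" "hook_omega T m (Onbhd m d (\<phi> x)) (Onbhd m (e x / 4) (\<phi> x))"
      using UV[OF x] r unfolding uniformly_UV_omega_def by blast
    have d2: "0 < d / 2" using d by simp
    obtain V1 where V1: "openin X V1" "x \<in> V1" "\<And>p. p \<in> V1 \<Longrightarrow> \<phi> p \<subseteq> Onbhd m (d / 2) (\<phi> x)"
      using rho d2 x unfolding rho_continuous_def by meson
    obtain V2 where V2: "openin X V2" "x \<in> V2" "\<And>p. p \<in> V2 \<Longrightarrow> \<phi> x \<subseteq> Onbhd m (e x / 4) (\<phi> p)"
      using rho r x unfolding rho_continuous_def by meson
    define V3 where "V3 = {p \<in> topspace X. e x / 2 < e p}"
    have V3: "openin X V3"
      unfolding V3_def using e by (intro openin_Collect_less) auto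
    have xV3: "x \<in> V3" unfolding V3_def using e0[OF x] x by simp
    show ?thesis
      using d V1 V2 V3 xV3 by (intro exI[of _ d] exI[of _ "V1 \<inter> V2 \<inter> V3"]) (auto simp: V3_def)
  qed
  then have "\<forall>x. \<exists>d V. x \<in> topspace X \<longrightarrow> (0 < d \<and> d \<le> e x / 4 \<and>
     hook_omega T m (Onbhd m d (\<phi> x)) (Onbhd m (e x / 4) (\<phi> x)) \<and>
     openin X V \<and> x \<in> V \<and> (\<forall>p\<in>V. \<phi> p \<subseteq> Onbhd m (d / 2) (\<phi> x) \<and> \<phi> x \<subseteq> Onbhd m (e x / 4) (\<phi> p) \<and> e x / 2 < e p))"
    by meson
  then obtain d V where dV: "\<forall>x. x \<in> topspace X \<longrightarrow> (0 < d x \<and> d x \<le> e x / 4 \<and>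
     hook_omega T m (Onbhd m (d x) (\<phi> x)) (Onbhd m (e x / 4) (\<phi> x)) \<and>
     openin X (V x) \<and> x \<in> V x \<and>
     (\<forall>p\<in>V x. \<phi> p \<subseteq> Onbhd m (d x / 2) (\<phi> x) \<and> \<phi> x \<subseteq> Onbhd m (e x / 4) (\<phi> p) \<and> e x / 2 < e p))"
    by (elim choice[elim_format] exE)
  have d0: "0 < d x" and de: "d x \<le> e x / 4"
    and hook: "hook_omega T m (Onbhd m (d x) (\<phi> x)) (Onbhd m (e x / 4) (\<phi> x))"
    and V: "openin X (V x)" "x \<in> V x"
    and near: "\<And>p. p \<in> V x \<Longrightarrow> \<phi> p \<subseteq> Onbhd m (d x / 2) (\<phi> x)"
      "\<And>p. p \<in> V x \<Longrightarrow> \<phi> x \<subseteq> Onbhd m (e x / 4) (\<phi> p)" "\<And>p. p \<in> V x \<Longrightarrow> e x / 2 < e p"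
    if "x \<in> topspace X" for x
    using dV that by auto
  have "\<exists>u. bump_family X (topspace X) V u"
    by (rule bump_family_exists[OF paracompact normal]) (use V in auto)
  then obtain u where u: "bump_family X (topspace X) V u" by blast
  define s w where "s = weighted_sum (topspace X) (\<lambda>_. 1) u"
    and "w = weighted_sum (topspace X) (\<lambda>x. d x / 2) u"
  \<comment> \<open>Half of the weighted mean of the \<open>d x / 2\<close>, hence strictly below
    \<open>d x / 2\<close> for at least one \<open>x\<close> whose bump is active at
    \<open>p\<close>.\<close>
  define e' where "e' p = w p / (2 * s p)" for p
  have peak: "1 \<le> s p" "0 < w p" if p: "p \<in> topspace X" for p
  proof -
    obtain i where i: "i \<in> topspace X" "u i p = 1" using bump_familyD(5)[OF u p] by blast
    have "sum (\<lambda>_. 1) {i} \<le> s p"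
      unfolding s_def by (rule weighted_sum_ge_sum[OF u p]) (use i in auto)
    then show "1 \<le> s p" by simp
    have "sum (\<lambda>x. d x / 2) {i} \<le> w p"
      unfolding w_def by (rule weighted_sum_ge_sum[OF u p]) (use i d0 in \<open>auto intro: less_imp_le\<close>)
    then show "0 < w p" using d0[OF i(1)] by simp
  qed
  have s0: "2 * s p \<noteq> 0" if "p \<in> topspace X" for p using peak(1)[OF that] by simp
  have e'c: "continuous_map X euclideanreal e'"
    unfolding e'_def s_def w_def
    by (intro continuous_map_real_divide continuous_map_real_mult_left continuous_map_weighted_sum[OF u])
       (use s0 in \<open>simp add: s_def\<close>)
  define V' where "V' x = V x \<inter> {p \<in> topspace X. e' p < d x / 2}" for x
  have cov: "\<exists>x\<in>topspace X. p \<in> V' x" if p: "p \<in> topspace X" for p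
  proof (rule ccontr)
    assume neg: "\<not> ?thesis"
    \<comment> \<open>If \<open>e' p\<close> were at least every active \<open>d i / 2\<close>, it
      would be at least their mean, which is \<open>2 * e' p\<close>.\<close>
    have "d i / 2 * u i p \<le> e' p * (1 * u i p)" if "i \<in> {i \<in> topspace X. u i p \<noteq> 0}" for i
    proof -
      have "p \<in> V i" using bump_familyD(4)[OF u _ p] that by blast
      then have "d i / 2 \<le> e' p" using neg that p by (force simp: V'_def)
      then show ?thesis using bump_familyD(2)[OF u _ p, of i] that by (auto intro: mult_right_mono)
    qed
    then have "w p \<le> e' p * s p"
      unfolding w_def s_def weighted_sum_def sum_distrib_left by (rule sum_mono)
    also have "\<dots> = w p / 2" using peak(1)[OF p] by (simp add: e'_def)
    finally show False using peak(2)[OF p] by simp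
  qed
  have small: "e' p \<le> e p" if "x \<in> topspace X" "p \<in> V' x" for x p
    using near(3)[OF that(1), of p] de[OF that(1)] d0[OF that(1)] that(2) by (auto simp: V'_def)
  show ?thesis
  proof (intro exI[of _ "V' ` topspace X"] exI[of _ e'] conjI ballI)
    show "continuous_map X euclideanreal e'" by (rule e'c)
    show "0 < e' x" if "x \<in> topspace X" for x using peak[OF that] by (simp add: e'_def)
    show "e' x \<le> e x" if "x \<in> topspace X" for x using cov[OF that] small by blast
    show "topspace X \<subseteq> \<Union>(V' ` topspace X)" using cov by blast
    fix U assume "U \<in> V' ` topspace X"
    then obtain x where x: "x \<in> topspace X" "U = V' x" by blast
    show "openin X U"
      using V(1)[OF x(1)] e'c unfolding x(2) V'_def by (intro openin_Int openin_Collect_less) auto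
    let ?A = "Onbhd m (d x) (\<phi> x)" and ?B = "Onbhd m (e x / 4) (\<phi> x)"
    have "Onbhd m (e' p) (\<phi> p) \<subseteq> ?A \<and> ?B \<subseteq> Onbhd m (e p) (\<phi> p)" if p: "p \<in> U" for p
    proof
      have pX: "p \<in> topspace X" and pV: "p \<in> V x" and ep: "e' p < d x / 2" using p x(2) by (auto simp: V'_def)
      have "Onbhd m (e' p) (\<phi> p) \<subseteq> Onbhd m (d x / 2) (\<phi> p)" using ep by (intro Onbhd_mono) simp
      also have "\<dots> \<subseteq> Onbhd m (d x / 2 + d x / 2) (\<phi> x)"
        using near(1)[OF x(1) pV] \<phi>[OF x(1)] by (intro Onbhd_Onbhd) auto
      finally show "Onbhd m (e' p) (\<phi> p) \<subseteq> ?A" by simp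
      have "?B \<subseteq> Onbhd m (e x / 4 + e x / 4) (\<phi> p)"
        using near(2)[OF x(1) pV] \<phi>[OF pX] by (intro Onbhd_Onbhd) auto
      also have "\<dots> \<subseteq> Onbhd m (e p) (\<phi> p)" using near(3)[OF x(1) pV] by (intro Onbhd_mono) simp
      finally show "?B \<subseteq> Onbhd m (e p) (\<phi> p)" .
    qed
    moreover have "?B \<noteq> {}" using subset_Onbhd[of "\<phi> x" m "e x / 4"] \<phi>[OF x(1)] e0[OF x(1)] by fastforce
    moreover have "?B \<subseteq> mspace m" by (auto simp: Onbhd_def)
    ultimately show "\<exists>A B. hook_omega T m A B \<and> B \<noteq> {} \<and> B \<subseteq> mspace m \<and>
        (\<forall>p\<in>U. Onbhd m (e' p) (\<phi> p) \<subseteq> A \<and> B \<subseteq> Onbhd m (e p) (\<phi> p))"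
      using hook[OF x(1)] by (intro exI[of _ ?A] exI[of _ ?B]) blast
  qed
qed

text \<open>The normalised bumps \<open>\<kappa>\<close> map \<open>X\<close> to the nerve, but
  \<open>g\<close> is continuous only on closed simplices. Near a point only the finitely many
  indices in \<open>F\<close> matter, so a neighbourhood is covered by finitely many closed sets
  \<open>Z \<tau>\<close>, each mapped by \<open>\<kappa>\<close> into one simplex, and pasting
  applies.\<close>

lemma carried_map_selection:
  assumes C: "\<And>v. v \<in> S \<Longrightarrow> openin X (C v)" and cov: "topspace X \<subseteq> (\<Union>v\<in>S. C v)"
    and g: "carried_map m C R (nerve S C) g"
  shows "\<exists>f. continuous_map X (mtopology_of m) f \<and> (\<forall>x\<in>topspace X. f x \<in> R x)"
proof -
  obtain u where u: "bump_family X S C u"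
    using bump_family_exists[OF paracompact normal C cov] by blast
  define s where "s = weighted_sum S (\<lambda>_. 1) u"
  have sc: "continuous_map X euclideanreal s"
    unfolding s_def by (rule continuous_map_weighted_sum[OF u])
  define \<sigma> where "\<sigma> x = {v\<in>S. u v x \<noteq> 0}" for x
  have s_eq: "s x = (\<Sum>v\<in>\<sigma> x. u v x)" for x
    by (simp add: s_def \<sigma>_def weighted_sum_def)
  have s1: "1 \<le> s x" if x: "x \<in> topspace X" for x
  proof -
    obtain i where i: "i \<in> S" "u i x = 1" using bump_familyD(5)[OF u x] by blast
    have "sum (\<lambda>_. 1) {i} \<le> s x"
      unfolding s_def by (rule weighted_sum_ge_sum[OF u x]) (use i in auto)
    then show ?thesis by simp
  qed
  define \<kappa> where "\<kappa> x v = (if v \<in> S then u v x / s x else 0)" for x v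
  have \<kappa>_geom: "\<kappa> x \<in> geom_simplex \<tau>" if x: "x \<in> topspace X" and t: "finite \<tau>" "\<sigma> x \<subseteq> \<tau>" "\<tau> \<subseteq> S" for x \<tau>
  proof -
    have "sum (\<kappa> x) \<tau> = (\<Sum>v\<in>\<tau>. u v x / s x)"
      using t(3) by (intro sum.cong) (auto simp: \<kappa>_def)
    also have "\<dots> = (\<Sum>v\<in>\<tau>. u v x) / s x" by (simp add: sum_divide_distrib)
    also have "(\<Sum>v\<in>\<tau>. u v x) = s x"
      unfolding s_eq using t by (intro sum.mono_neutral_right) (auto simp: \<sigma>_def)
    finally have "sum (\<kappa> x) \<tau> = 1" using s1[OF x] by simp
    moreover have "0 \<le> \<kappa> x v" for v
      using bump_familyD(2)[OF u _ x, of v] s1[OF x] by (simp add: \<kappa>_def)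
    moreover have "\<kappa> x v = 0" if "v \<notin> \<tau>" for v
      using that t by (auto simp: \<kappa>_def \<sigma>_def)
    ultimately show ?thesis by (simp add: geom_simplex_def)
  qed
  have \<sigma>_nerve: "\<sigma> x \<in> nerve S C" "x \<in> (\<Inter>v\<in>\<sigma> x. C v)" if x: "x \<in> topspace X" for x
  proof -
    show x': "x \<in> (\<Inter>v\<in>\<sigma> x. C v)" using bump_familyD(4)[OF u _ x] by (auto simp: \<sigma>_def)
    obtain i where "i \<in> S" "u i x = 1" using bump_familyD(5)[OF u x] by blast
    then have "\<sigma> x \<noteq> {}" by (auto simp: \<sigma>_def)
    moreover have "finite (\<sigma> x)" unfolding \<sigma>_def by (rule bump_family_finite_support[OF u x])
    moreover have "\<sigma> x \<subseteq> S" by (auto simp: \<sigma>_def)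
    ultimately show "\<sigma> x \<in> nerve S C" using x' unfolding nerve_def by blast
  qed
  have nerveD: "finite \<tau>" "\<tau> \<subseteq> S" if "\<tau> \<in> nerve S C" for \<tau> using that by (auto simp: nerve_def)
  have "continuous_map X (mtopology_of m) (\<lambda>x. g (\<kappa> x))"
  proof (rule continuous_map_openin_cover)
    fix x assume x: "x \<in> topspace X"
    obtain N where N: "openin X N" "x \<in> N" and fin: "finite {v\<in>S. \<exists>y\<in>N. u v y \<noteq> 0}"
      using bump_familyD(6)[OF u x] by blast
    define F where "F = {v\<in>S. \<exists>y\<in>N. u v y \<noteq> 0}"
    have F: "finite F" "F \<subseteq> S" using fin by (auto simp: F_def)
    have NX: "N \<subseteq> topspace X" using openin_subset[OF N(1)] .
    let ?I = "{\<tau> \<in> nerve S C. \<tau> \<subseteq> F}"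
    define Z where "Z \<tau> = {y \<in> topspace (subtopology X N). \<forall>v\<in>F - \<tau>. u v y = 0}" for \<tau>
    have ucN: "continuous_map (subtopology X N) euclideanreal (u v)" if "v \<in> S" for v
      using bump_familyD(1)[OF u that] by (rule continuous_map_from_subtopology)
    have "continuous_map (subtopology X N) (mtopology_of m) (\<lambda>x. g (\<kappa> x))"
    proof (rule pasting_lemma_closed[where I="?I" and T=Z and f="\<lambda>_ x. g (\<kappa> x)"])
      show "finite ?I" by (rule finite_subset[of _ "Pow F"]) (use F in auto)
      show "\<exists>\<tau>. \<tau> \<in> ?I \<and> y \<in> Z \<tau> \<and> g (\<kappa> y) = g (\<kappa> y)" if "y \<in> topspace (subtopology X N)" for y
        using that \<sigma>_nerve(1)[of y] by (intro exI[of _ "\<sigma> y"]) (auto simp: Z_def \<sigma>_def F_def)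
    next
      fix \<tau> assume t: "\<tau> \<in> ?I"
      show "closedin (subtopology X N) (Z \<tau>)"
      proof -
        \<comment> \<open>Bumps are nonnegative, so their common zero set is the zero set of one
          continuous sum.\<close>
        have "continuous_map (subtopology X N) euclideanreal (\<lambda>y. \<Sum>v\<in>F - \<tau>. u v y)"
          using F ucN by (intro continuous_map_sum) auto
        then have "closedin (subtopology X N) {y \<in> topspace (subtopology X N). (\<Sum>v\<in>F - \<tau>. u v y) \<in> {0}}"
          by (rule closedin_continuous_map_preimage) simp
        moreover have "{y \<in> topspace (subtopology X N). (\<Sum>v\<in>F - \<tau>. u v y) \<in> {0}} = Z \<tau>"
        proof -
          have "(\<Sum>v\<in>F - \<tau>. u v y) = 0 \<longleftrightarrow> (\<forall>v\<in>F - \<tau>. u v y = 0)" if "y \<in> topspace X" for y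
            using F bump_familyD(2)[OF u _ that] by (intro sum_nonneg_eq_0_iff) auto
          then show ?thesis unfolding Z_def by auto
        qed
        ultimately show ?thesis by simp
      qed
      let ?Y = "subtopology (subtopology X N) (Z \<tau>)"
      have uc: "continuous_map ?Y euclideanreal (u v)" if "v \<in> S" for v
        using ucN[OF that] by (rule continuous_map_from_subtopology)
      have sc': "continuous_map ?Y euclideanreal s"
        by (intro continuous_map_from_subtopology sc)
      have "continuous_map ?Y (powertop_real UNIV) \<kappa>"
        unfolding continuous_map_componentwise_UNIV
      proof
        fix v
        show "continuous_map ?Y euclideanreal (\<lambda>x. \<kappa> x v)"
        proof (cases "v \<in> S")
          case True
          have "continuous_map ?Y euclideanreal (\<lambda>x. u v x / s x)"
            using s1 by (intro continuous_map_real_divide uc[OF True] sc') force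
          then show ?thesis using True by (simp add: \<kappa>_def)
        qed (simp add: \<kappa>_def)
      qed
      moreover have "\<kappa> y \<in> geom_simplex \<tau>" if y: "y \<in> topspace ?Y" for y
      proof (rule \<kappa>_geom)
        have y': "y \<in> topspace X" "y \<in> N" "y \<in> Z \<tau>" using y by auto
        then show "y \<in> topspace X" by simp
        show "finite \<tau>" "\<tau> \<subseteq> S" using t nerveD by auto
        show "\<sigma> y \<subseteq> \<tau>" using y' by (auto simp: \<sigma>_def Z_def F_def)
      qed
      ultimately have "continuous_map ?Y (simplex_topology \<tau>) \<kappa>"
        unfolding continuous_map_in_subtopology by blast
      moreover have "continuous_map (simplex_topology \<tau>) (mtopology_of m) g"
        using g t unfolding carried_map_def by blast
      ultimately have "continuous_map ?Y (mtopology_of m) (g \<circ> \<kappa>)" by (rule continuous_map_compose)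
      then show "continuous_map ?Y (mtopology_of m) (\<lambda>x. g (\<kappa> x))" by (simp add: o_def)
    qed auto
    then show "\<exists>N. openin X N \<and> x \<in> N \<and> continuous_map (subtopology X N) (mtopology_of m) (\<lambda>x. g (\<kappa> x))"
      using N by blast
  qed
  moreover have "g (\<kappa> x) \<in> R x" if x: "x \<in> topspace X" for x
  proof -
    have "\<kappa> x \<in> geom_simplex (\<sigma> x)"
      by (rule \<kappa>_geom[OF x]) (use nerveD[OF \<sigma>_nerve(1)[OF x]] in auto)
    then show ?thesis using g \<sigma>_nerve[OF x] unfolding carried_map_def by blast
  qed
  ultimately show ?thesis by blast
qed

end

theorem theorem5p2:
  fixes X :: "'a topology" and m :: "'b metric"
    and \<phi> :: "'a \<Rightarrow> 'b set" and \<epsilon> :: "'a \<Rightarrow> real"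
  assumes "paracompact_space X" and "finite_C_space X"
    and "\<forall>x\<in>topspace X. \<phi> x \<noteq> {} \<and> \<phi> x \<subseteq> mspace m"
    and "rho_continuous X m \<phi>"
    and "\<forall>x\<in>topspace X. uniformly_UV_omega TYPE((nat \<times> 'a set) set) m (\<phi> x)"
    and "continuous_map X euclideanreal \<epsilon>" and "\<forall>x\<in>topspace X. \<epsilon> x > 0"
  shows "\<exists>f. continuous_map X (mtopology_of m) f \<and>
             (\<forall>x\<in>topspace X. f x \<in> Onbhd m (\<epsilon> x) (\<phi> x))"
proof -
  have "normal_space X" using assms(2) by (simp add: finite_C_space_def)
  then interpret paracompact_normal X using assms(1) by unfold_locales
  define good where "good e \<longleftrightarrow> continuous_map X euclideanreal e \<and> (\<forall>x\<in>topspace X. 0 < e x)" for e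
  define next_scale where "next_scale e \<U> e' \<longleftrightarrow> good e' \<and> (\<forall>x\<in>topspace X. e' x \<le> e x) \<and>
     (\<forall>U\<in>\<U>. openin X U) \<and> topspace X \<subseteq> \<Union>\<U> \<and>
     (\<forall>U\<in>\<U>. \<exists>A B. hook_omega TYPE((nat \<times> 'a set) set) m A B \<and> B \<noteq> {} \<and> B \<subseteq> mspace m \<and>
        (\<forall>p\<in>U. Onbhd m (e' p) (\<phi> p) \<subseteq> A \<and> B \<subseteq> Onbhd m (e p) (\<phi> p)))" for e \<U> e'
  have "\<exists>\<U> e'. next_scale e \<U> e'" if "good e" for e
  proof -
    have "\<exists>\<U> e'. continuous_map X euclideanreal e' \<and> (\<forall>x\<in>topspace X. 0 < e' x \<and> e' x \<le> e x) \<and>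
     (\<forall>U\<in>\<U>. openin X U) \<and> topspace X \<subseteq> \<Union>\<U> \<and>
     (\<forall>U\<in>\<U>. \<exists>A B. hook_omega TYPE((nat \<times> 'a set) set) m A B \<and> B \<noteq> {} \<and> B \<subseteq> mspace m \<and>
        (\<forall>p\<in>U. Onbhd m (e' p) (\<phi> p) \<subseteq> A \<and> B \<subseteq> Onbhd m (e p) (\<phi> p)))"
      by (rule scale_step) (use assms that in \<open>auto simp: good_def\<close>)
    then show ?thesis unfolding next_scale_def good_def by (elim exE conjE) (intro exI conjI, auto)
  qed
  then obtain cv nx where nx: "\<And>e. good e \<Longrightarrow> next_scale e (cv e) (nx e)" by metis
  \<comment> \<open>All scales and covers are fixed before \<open>k\<close> is known, since the
    finite C-property must receive the whole sequence.\<close>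
  define E where "E = rec_nat \<epsilon> (\<lambda>_. nx)"
  have E0: "E 0 = \<epsilon>" and ES: "E (Suc n) = nx (E n)" for n by (simp_all add: E_def)
  have goodE: "good (E n)" for n
  proof (induction n)
    case 0
    then show ?case using assms by (simp add: E0 good_def)
  next
    case (Suc n)
    then show ?case using nx[OF Suc] by (simp add: ES next_scale_def)
  qed
  have step: "next_scale (E n) (cv (E n)) (E (Suc n))" for n using nx[OF goodE] by (simp add: ES)
  define \<U> where "\<U> n = cv (E n)" for n
  have \<U>: "\<And>n. \<forall>U\<in>\<U> n. openin X U" "\<And>n. topspace X \<subseteq> \<Union>(\<U> n)"
    using step by (auto simp: next_scale_def \<U>_def)
  obtain k \<V> where \<V>0: "\<forall>n<k. (\<forall>V\<in>\<V> n. openin X V \<and> (\<exists>U\<in>\<U> n. V \<subseteq> U)) \<and> pairwise disjnt (\<V> n)"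
    and cov: "topspace X \<subseteq> (\<Union>n<k. \<Union>(\<V> n))"
    using finite_C_space_arbitrary_covers[OF assms(2), where \<U>=\<U>, OF \<U>] by (elim exE conjE)
  \<comment> \<open>Singletons of pairs fit the vertex type in the UV hypothesis. The index in the
    pair keeps equal sets of different families apart and serves as the level.\<close>
  define S where "S = {{(n, V)} |n V. n < k \<and> V \<in> \<V> n}"
  define lev where "lev v = fst (the_elem v)" for v :: "(nat \<times> 'a set) set"
  define C where "C v = snd (the_elem v)" for v :: "(nat \<times> 'a set) set"
  have SE: "\<exists>n V. v = {(n, V)} \<and> n < k \<and> V \<in> \<V> n \<and> lev v = n \<and> C v = V" if "v \<in> S" for v
    using that by (auto simp: S_def lev_def C_def)
  have "\<exists>g. carried_map m C (\<lambda>p. Onbhd m (E 0 p) (\<phi> p)) (nerve S C) g"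
  proof (rule carried_map_exists[where R="\<lambda>n p. Onbhd m (E n p) (\<phi> p)" and lev=lev and k=k])
    fix v assume v: "v \<in> S"
    obtain n V where nV: "v = {(n, V)}" "n < k" "V \<in> \<V> n" "lev v = n" "C v = V" using SE[OF v] by blast
    show "lev v < k" using nV by simp
    show "disjnt (C v) (C w)" if w: "w \<in> S" "lev v = lev w" "v \<noteq> w" for w
    proof -
      obtain n' V' where "w = {(n', V')}" "n' < k" "V' \<in> \<V> n'" "lev w = n'" "C w = V'" using SE[OF w(1)] by blast
      then show ?thesis using nV w \<V>0 by (auto simp: pairwise_def)
    qed
    obtain U where U: "U \<in> \<U> n" "V \<subseteq> U" using \<V>0 nV by blast
    then have "\<exists>A B. hook_omega TYPE((nat \<times> 'a set) set) m A B \<and> B \<noteq> {} \<and> B \<subseteq> mspace m \<and>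
        (\<forall>p\<in>U. Onbhd m (E (Suc n) p) (\<phi> p) \<subseteq> A \<and> B \<subseteq> Onbhd m (E n p) (\<phi> p))"
      using step[of n] unfolding next_scale_def \<U>_def by blast
    then show "\<exists>A B. hook_omega TYPE((nat \<times> 'a set) set) m A B \<and> B \<noteq> {} \<and> B \<subseteq> mspace m \<and>
        (\<forall>p\<in>C v. Onbhd m (E (Suc (lev v)) p) (\<phi> p) \<subseteq> A \<and> B \<subseteq> Onbhd m (E (lev v) p) (\<phi> p))"
      using U(2) unfolding nV(4,5) by (elim exE conjE) (intro exI conjI, auto)
    fix j p assume p: "p \<in> C v"
    have "openin X V" using \<V>0 nV by blast
    then have "p \<in> topspace X" using p nV(5) openin_subset by blast
    then have "E (Suc j) p \<le> E j p" using step[of j] by (simp add: next_scale_def)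
    then show "Onbhd m (E (Suc j) p) (\<phi> p) \<subseteq> Onbhd m (E j p) (\<phi> p)" by (rule Onbhd_mono)
  qed
  then obtain g where g: "carried_map m C (\<lambda>p. Onbhd m (\<epsilon> p) (\<phi> p)) (nerve S C) g"
    unfolding E0 by blast
  show ?thesis
  proof (rule carried_map_selection[OF _ _ g])
    show "openin X (C v)" if v: "v \<in> S" for v
    proof -
      obtain n V where "n < k" "V \<in> \<V> n" "C v = V" using SE[OF v] by (elim exE conjE)
      then show ?thesis using \<V>0 by simp
    qed
    show "topspace X \<subseteq> (\<Union>v\<in>S. C v)"
    proof
      fix x assume "x \<in> topspace X"
      then obtain n V where nV: "n < k" "V \<in> \<V> n" "x \<in> V" using cov by blast
      then have "{(n, V)} \<in> S" "C {(n, V)} = V" by (auto simp: S_def C_def)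
      then show "x \<in> (\<Union>v\<in>S. C v)" using nV(3) by blast
    qed
  qed
qed

end
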